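(* Let $a_1,\ldots,a_n,b_1,\ldots,b_m$ be positive integers. Suppose $\mathrm{VI}(X,F)$ is defined by polynomials, with $F=(F_1,\ldots,F_n)$ and $X=\{x\in\mathbb{R}^n: g_i(x)\ge 0\ (i\in\mathcal{I}),\ g_i(x)=0\ (i\in\mathcal{E})\}$, such that $F_i$ is a generic polynomial in $x=(x_1,\ldots,x_n)$ of degree at most $a_i$ for every $i\in\{1,\ldots,n\}$ and $g_j$ is a generic polynomial in $x$ of degree at most $b_j$ for every $j\in\{1,\ldots,m\}$. Then every $x\in\mathrm{SOL}(X,F)$ is a KKT point of $\mathrm{VI}(X,F)$, and $|\mathcal{K}|<\infty$.
   Context: $\mathcal{E}$ and $\mathcal{I}$ are disjoint index sets with $\mathcal{E}\cup\mathcal{I}=\{1,\ldots,m\}$. $\mathrm{VI}(X,F)$ is the problem of finding $x\in X$ such that $(y-x)^TF(x)\ge 0$ for all $y\in X$; its solution set is $\mathrm{SOL}(X,F)$. "Generic" means: the conclusion holds for all coefficient vectors of $(F_1,\ldots,F_n,g_1,\ldots,g_m)$, in the space of real polynomials with the given degree bounds, outside a set of Lebesgue measure zero. A point $x\in\mathbb{R}^n$ is a KKT point of $\mathrm{VI}(X,F)$ if there exists $\lambda=(\lambda_1,\ldots,\lambda_m)\in\mathbb{R}^m$ such that $$F(x)=\sum_{i=1}^m\lambda_i\nabla g_i(x),\quad g_i(x)=0\ (i\in\mathcal{E}),\quad \lambda_i\ge0,\ g_i(x)\ge0,\ \lambda_i g_i(x)=0\ (i\in\mathcal{I}).$$ $\mathcal{K}$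 denotes the set of all KKT points. (In the paper $\mathcal{K}$ is described by substituting polynomial expressions $\lambda_i=\lambda_i(x)$ for the multipliers, which exist for generic $g$; it is then the same set.) *)

theory Defs
  imports "HOL-Analysis.Analysis"
begin

definition exponents :: "nat \<Rightarrow> ('n::finite \<Rightarrow> nat) set" where
  "exponents d = {\<alpha>. (\<Sum>i\<in>UNIV. \<alpha> i) \<le> d}"

definition poly_fun :: "nat \<Rightarrow> (('n::finite \<Rightarrow> nat) \<Rightarrow> real) \<Rightarrow> real ^ 'n \<Rightarrow> real" where
  "poly_fun d c x = (\<Sum>\<alpha>\<in>exponents d. c \<alpha> * (\<Prod>i\<in>UNIV. (x $ i) ^ \<alpha> i))"

text \<open>The sum in \<^const>\<open>poly_fun\<close> and the product measure below range over finite sets.\<close>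

lemma finite_exponents: "finite (exponents d :: ('n::finite \<Rightarrow> nat) set)"
proof (rule finite_subset)
  show "(exponents d :: ('n \<Rightarrow> nat) set) \<subseteq> PiE UNIV (\<lambda>_. {..d})"
  proof
    fix \<alpha> :: "'n \<Rightarrow> nat" assume "\<alpha> \<in> exponents d"
    then have le: "(\<Sum>i\<in>UNIV. \<alpha> i) \<le> d" by (simp add: exponents_def)
    have "\<alpha> i \<le> (\<Sum>i\<in>UNIV. \<alpha> i)" for i by (rule member_le_sum) auto
    with le show "\<alpha> \<in> PiE UNIV (\<lambda>_. {..d})" by (auto intro: order_trans)
  qed
qed (auto intro: finite_PiE)

text \<open>
  The coefficient of the monomial \<open>\<alpha>\<close> in \<open>F i\<close> sits at index \<open>(Inl i, \<alpha>)\<close>,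
  and the one in \<open>g j\<close> at index \<open>(Inr j, \<alpha>)\<close>.
\<close>

definition coeff_index ::
  "('n::finite \<Rightarrow> nat) \<Rightarrow> (nat \<Rightarrow> nat) \<Rightarrow> nat \<Rightarrow> (('n + nat) \<times> ('n \<Rightarrow> nat)) set" where
  "coeff_index a b m =
     {(Inl i, \<alpha>) | i \<alpha>. \<alpha> \<in> exponents (a i)} \<union>
     {(Inr j, \<alpha>) | j \<alpha>. j \<in> {1..m} \<and> \<alpha> \<in> exponents (b j)}"

lemma finite_coeff_index: "finite (coeff_index a b m)"
proof -
  have "coeff_index a b m =
      (\<Union>i. Pair (Inl i) ` exponents (a i)) \<union> (\<Union>j\<in>{1..m}. Pair (Inr j) ` exponents (b j))"
    unfolding coeff_index_def by auto
  then show ?thesis by (simp add: finite_exponents)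
qed

definition coeff_measure ::
  "('n::finite \<Rightarrow> nat) \<Rightarrow> (nat \<Rightarrow> nat) \<Rightarrow> nat \<Rightarrow> (('n + nat) \<times> ('n \<Rightarrow> nat) \<Rightarrow> real) measure" where
  "coeff_measure a b m = PiM (coeff_index a b m) (\<lambda>_. lborel)"

definition poly_map ::
  "('n::finite \<Rightarrow> nat) \<Rightarrow> (('n + nat) \<times> ('n \<Rightarrow> nat) \<Rightarrow> real) \<Rightarrow> real ^ 'n \<Rightarrow> real ^ 'n" where
  "poly_map a c x = (\<chi> i. poly_fun (a i) (\<lambda>\<alpha>. c (Inl i, \<alpha>)) x)"

definition poly_constraint ::
  "(nat \<Rightarrow> nat) \<Rightarrow> (('n::finite + nat) \<times> ('n \<Rightarrow> nat) \<Rightarrow> real) \<Rightarrow> nat \<Rightarrow> real ^ 'n \<Rightarrow> real" where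
  "poly_constraint b c j x = poly_fun (b j) (\<lambda>\<alpha>. c (Inr j, \<alpha>)) x"

definition feasible_set ::
  "nat set \<Rightarrow> nat set \<Rightarrow> (nat \<Rightarrow> real ^ 'n \<Rightarrow> real) \<Rightarrow> (real ^ 'n) set" where
  "feasible_set \<E> \<I> g = {x. (\<forall>i\<in>\<I>. g i x \<ge> 0) \<and> (\<forall>i\<in>\<E>. g i x = 0)}"

definition SOL :: "(real ^ 'n) set \<Rightarrow> (real ^ 'n \<Rightarrow> real ^ 'n) \<Rightarrow> (real ^ 'n) set" where
  "SOL X F = {x \<in> X. \<forall>y\<in>X. (y - x) \<bullet> F x \<ge> 0}"

definition gradient :: "('a::real_inner \<Rightarrow> real) \<Rightarrow> 'a \<Rightarrow> 'a" where
  "gradient f x = (THE D. GDERIV f x :> D)"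

lemma gradient_eqI: "GDERIV f x :> D \<Longrightarrow> gradient f x = D"
  unfolding gradient_def
proof (rule the_equality)
  fix D' assume "GDERIV f x :> D" "GDERIV f x :> D'"
  then have "(\<lambda>h. h \<bullet> D') = (\<lambda>h. h \<bullet> D)"
    unfolding gderiv_def by (metis has_derivative_unique)
  then have "(D' - D) \<bullet> D' = (D' - D) \<bullet> D" by meson
  then have "(D' - D) \<bullet> (D' - D) = 0" by (simp add: inner_diff_right)
  then show "D' = D" by simp
qed

text \<open>Polynomials have a gradient everywhere, so the \<open>THE\<close> above is never undetermined for them.\<close>

lemma GDERIV_poly_fun:
  fixes x :: "real ^ 'a"
  shows "GDERIV (poly_fun d c) x :> gradient (poly_fun d c) x"
proof -
  have coord: "(\<lambda>x::real ^ 'a. x $ i) differentiable (at x)" for i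
    by (rule bounded_linear_imp_differentiable) (rule bounded_linear_vec_nth)
  have "(\<lambda>x::real ^ 'a. \<Prod>i\<in>S. (x $ i) ^ \<alpha> i) differentiable (at x)" if "finite S" for S \<alpha>
    using that
    by induction (auto intro!: derivative_intros coord)
  then have "poly_fun d c differentiable (at x)"
    unfolding poly_fun_def by (auto intro!: derivative_intros simp: finite_exponents)
  then obtain f' where f': "(poly_fun d c has_derivative f') (at x)"
    unfolding differentiable_def by blast
  then interpret f': bounded_linear f' by (rule has_derivative_bounded_linear)
  have "f' h = h \<bullet> (\<Sum>b\<in>Basis. f' b *\<^sub>R b)" for h
  proof -
    have "f' h = f' (\<Sum>b\<in>Basis. (h \<bullet> b) *\<^sub>R b)" by (simp add: euclidean_representation)
    also have "\<dots> = (\<Sum>b\<in>Basis. (h \<bullet> b) *\<^sub>R f' b)" by (simp only: f'.sum f'.scaleR)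
    also have "\<dots> = h \<bullet> (\<Sum>b\<in>Basis. f' b *\<^sub>R b)"
      by (simp add: inner_sum_right mult.commute)
    finally show ?thesis .
  qed
  with f' have "GDERIV (poly_fun d c) x :> (\<Sum>b\<in>Basis. f' b *\<^sub>R b)"
    unfolding gderiv_def by (metis (no_types, lifting) ext)
  then show ?thesis using gradient_eqI by metis
qed

definition KKT_set ::
  "nat set \<Rightarrow> nat set \<Rightarrow> (real ^ 'n \<Rightarrow> real ^ 'n) \<Rightarrow> (nat \<Rightarrow> real ^ 'n \<Rightarrow> real) \<Rightarrow> (real ^ 'n) set" where
  "KKT_set \<E> \<I> F g = {x. \<exists>\<mu>::nat \<Rightarrow> real.
     F x = (\<Sum>i\<in>\<E> \<union> \<I>. \<mu> i *\<^sub>R gradient (g i) x) \<and>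
     (\<forall>i\<in>\<E>. g i x = 0) \<and>
     (\<forall>i\<in>\<I>. \<mu> i \<ge> 0 \<and> g i x \<ge> 0 \<and> \<mu> i * g i x = 0)}"

end

theory Submission
  imports Defs "HOL-Library.Function_Algebras"
begin

text \<open>
  The two claims reduce to two generic properties of the coefficients. First, at every point the
  gradients of the active constraints are linearly independent. Then a solution
  \<open>x\<close> of the variational inequality, which minimises the linear function
  \<open>y \<mapsto> (y - x) \<bullet> F x\<close> over the feasible set, has Lagrange multipliers
  (\<open>KKT_multipliers_exist\<close>). Secondly, for every choice of at most \<open>n\<close> constraints \<open>g_j\<close>, the system
  \<open>F x = \<Sum>u_j \<nabla>g_j x\<close>, \<open>g_j x = 0\<close> has finitely many solutions \<open>x\<close>. By the first property at most
  \<open>n\<close> constraints are active at a KKT point, so every KKT point solves one of finitely many such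
  systems.

  Both properties come from one statement (\<open>AE_finite_gradient_span\<close>) about systems
  \<open>G x = \<Sum>u_j \<nabla>g_j x\<close>, \<open>g_j x = 0\<close> with as many equations as unknowns \<open>(x, u)\<close>: if \<open>G\<close> has free
  constant terms, then generically only finitely many \<open>x\<close> occur. With \<open>G = F\<close> this is the second
  property. With \<open>G = \<nabla>g_i\<close>, whose constant terms are the linear coefficients of a further constraint
  \<open>g_i\<close>, it says that among the common zeros of the constraints \<open>g_j\<close> only finitely many make \<open>\<nabla>g_i\<close> a linear
  combination of the gradients \<open>\<nabla>g_j\<close>. The equations do not involve the constant term of \<open>g_i\<close>, so for almost all values of that term \<open>g_i\<close>
  vanishes at none of these points. This gives the first property.

  The finiteness statement combines three facts.

  \<^item> The right-hand sides of a square system form a Lebesgue null set if they are values at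
    points with singular derivative (Sard). Hence for almost all constant terms every zero is
    nondegenerate.
  \<^item> A square polynomial system has only finitely many nondegenerate real zeros
    (\<open>finite_nondegenerate_zeros\<close>). They survive the perturbation of the \<open>i\<close>-th equation by
    \<open>\<epsilon> x_i ^ d\<close>, with \<open>d\<close> above all degrees. On the zeros of the perturbed system every
    polynomial reduces to a combination of the \<open>d ^ N\<close> monomials with exponents below \<open>d\<close>, while
    polynomials separate points; so there are at most \<open>d ^ N\<close> zeros.
  \<^item> Genericity in a few coefficients for each value of the others implies genericity in
    all of them, because Lebesgue measure is translation invariant (\<open>AE_PiM_lborel_probe\<close>).
\<close>

section \<open>Nondegenerate zeros of a square polynomial system\<close>

definition monomial :: "('n::finite \<Rightarrow> nat) \<Rightarrow> real ^ 'n \<Rightarrow> real" where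
  "monomial \<alpha> x = (\<Prod>i\<in>UNIV. (x $ i) ^ \<alpha> i)"

lemma poly_fun_monomial: "poly_fun d c x = (\<Sum>\<alpha>\<in>exponents d. c \<alpha> * monomial \<alpha> x)"
  by (simp add: poly_fun_def monomial_def)

lemma monomial_add: "monomial (\<lambda>i. \<alpha> i + \<beta> i) x = monomial \<alpha> x * monomial \<beta> x"
  by (simp add: monomial_def power_add prod.distrib)

lemma sum_fun_apply: "(\<Sum>i\<in>A. f i) x = (\<Sum>i\<in>A. f i x)"
  by (induction A rule: infinite_finite_induct) auto

text \<open>
  Polynomials, and their restrictions to a finite set of points, are treated as vectors in the space of
  all real functions, so that spans and dimension bounds apply to them directly.
\<close>

interpretation funs: vector_space "\<lambda>(r::real) (f::'a \<Rightarrow> real) x. r * f x"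
  by unfold_locales (auto simp: fun_eq_iff algebra_simps)

definition polys_upto :: "nat \<Rightarrow> (real ^ 'n::finite \<Rightarrow> real) set" where
  "polys_upto e = funs.span (monomial ` exponents e)"

lemma polys_upto_mono: "e \<le> e' \<Longrightarrow> polys_upto e \<subseteq> polys_upto e'"
  unfolding polys_upto_def by (intro funs.span_mono image_mono) (auto simp: exponents_def)

lemma monomial_in_polys_upto: "sum \<alpha> UNIV \<le> e \<Longrightarrow> monomial \<alpha> \<in> polys_upto e"
  unfolding polys_upto_def by (rule funs.span_base) (auto simp: exponents_def)

lemma polys_upto_mult:
  assumes "f \<in> polys_upto e" "g \<in> polys_upto e'"
  shows "(\<lambda>x. f x * g x) \<in> polys_upto (e + e')"
proof -
  have 1: "(\<lambda>x. monomial \<alpha> x * g x) \<in> polys_upto (e + e')" if "\<alpha> \<in> exponents e" for \<alpha>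
    using assms(2) unfolding polys_upto_def[of e']
  proof (induction rule: funs.span_induct_alt)
    case base
    then show ?case unfolding polys_upto_def using funs.span_zero by (simp add: zero_fun_def)
  next
    case (step c f g)
    then obtain \<beta> where \<beta>: "\<beta> \<in> exponents e'" "f = monomial \<beta>" by auto
    have "monomial (\<lambda>i. \<alpha> i + \<beta> i) \<in> polys_upto (e + e')"
      using that \<beta> by (intro monomial_in_polys_upto) (auto simp: exponents_def sum.distrib)
    then have "(\<lambda>x. c * monomial (\<lambda>i. \<alpha> i + \<beta> i) x) + (\<lambda>x. monomial \<alpha> x * g x) \<in> polys_upto (e + e')"
      using step(2) unfolding polys_upto_def by (intro funs.span_add funs.span_scale)
    then show ?case by (simp add: \<beta> plus_fun_def monomial_add algebra_simps)
  qed
  show ?thesis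
    using assms(1) unfolding polys_upto_def[of e]
  proof (induction rule: funs.span_induct_alt)
    case base
    then show ?case unfolding polys_upto_def using funs.span_zero by (simp add: zero_fun_def)
  next
    case (step c h f)
    then obtain \<alpha> where \<alpha>: "\<alpha> \<in> exponents e" "h = monomial \<alpha>" by auto
    have "(\<lambda>x. c * (monomial \<alpha> x * g x)) + (\<lambda>x. f x * g x) \<in> polys_upto (e + e')"
      using step(2) 1[OF \<alpha>(1)] unfolding polys_upto_def by (intro funs.span_add funs.span_scale)
    then show ?case by (simp add: \<alpha> plus_fun_def algebra_simps)
  qed
qed

lemma monomial_single: "monomial (\<lambda>j. if j = i then k else 0) x = (x $ i) ^ k"
proof -
  have "monomial (\<lambda>j. if j = i then k else 0) x = (\<Prod>j\<in>UNIV. if j = i then (x $ i) ^ k else 1)"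
    unfolding monomial_def by (intro prod.cong) auto
  then show ?thesis by simp
qed

lemma real_polynomial_function_in_polys_upto:
  fixes f :: "real ^ 'n::finite \<Rightarrow> real"
  assumes "real_polynomial_function f"
  shows "\<exists>e. f \<in> polys_upto e"
  using assms
proof induction
  case (linear f)
  interpret f: bounded_linear f by fact
  have "f = (\<Sum>i\<in>UNIV. (\<lambda>x. f (axis i 1) * monomial (\<lambda>j. if j = i then 1 else 0) x))"
  proof
    fix x :: "real ^ 'n"
    have "f x = f (\<Sum>i\<in>UNIV. (x $ i) *\<^sub>R axis i 1)"
      using basis_expansion[of x] by (simp add: scalar_mult_eq_scaleR)
    also have "\<dots> = (\<Sum>i\<in>UNIV. f (axis i 1) * monomial (\<lambda>j. if j = i then 1 else 0) x)"
      by (simp only: f.sum f.scaleR monomial_single) (simp add: mult.commute)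
    finally show "f x = (\<Sum>i\<in>UNIV. (\<lambda>x. f (axis i 1) * monomial (\<lambda>j. if j = i then 1 else 0) x)) x"
      by (simp add: sum_fun_apply)
  qed
  moreover have "\<dots> \<in> polys_upto 1"
    unfolding polys_upto_def
    by (intro funs.span_sum funs.span_scale funs.span_base) (auto simp: exponents_def)
  ultimately show ?case by metis
next
  case (const c)
  have "(\<lambda>x. c * monomial (\<lambda>_. 0) x) \<in> polys_upto 0"
    unfolding polys_upto_def by (intro funs.span_scale funs.span_base) (auto simp: exponents_def)
  then show ?case by (auto simp: monomial_def)
next
  case (add f g)
  then obtain e e' where "f \<in> polys_upto e" "g \<in> polys_upto e'" by auto
  then have "f \<in> polys_upto (max e e')" "g \<in> polys_upto (max e e')"
    using polys_upto_mono[of e "max e e'"] polys_upto_mono[of e' "max e e'"] by auto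
  then have "f + g \<in> polys_upto (max e e')"
    unfolding polys_upto_def by (rule funs.span_add)
  then show ?case by (auto simp: plus_fun_def)
next
  case (mult f g)
  then show ?case using polys_upto_mult by blast
qed

text \<open>
  The relations \<open>z_i ^ d = Q_i z\<close> with \<open>deg Q_i < d\<close> rewrite, on \<open>Z\<close>, any monomial with an exponent at least \<open>d\<close>
  into monomials of smaller total degree. Hence the \<open>d ^ N\<close> monomials with all exponents below \<open>d\<close> span
  the restrictions of all polynomials to \<open>Z\<close>. By interpolation these restrictions include the
  indicator functions of the points of \<open>Z\<close>, which are linearly independent.
\<close>

lemma card_reduced_zeros:
  fixes Z :: "(real ^ 'n::finite) set"
  assumes "finite Z" and "e < d"
    and red: "\<And>i. \<exists>Q\<in>polys_upto e. \<forall>z\<in>Z. (z $ i) ^ d = Q z"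
  shows "card Z \<le> d ^ CARD('n)"
proof -
  define restr :: "(real ^ 'n \<Rightarrow> real) \<Rightarrow> (real ^ 'n \<Rightarrow> real)"
    where "restr f = (\<lambda>x. if x \<in> Z then f x else 0)" for f
  define R :: "('n \<Rightarrow> nat) set" where "R = {\<beta>. \<forall>i. \<beta> i < d}"
  have R_PiE: "R = PiE UNIV (\<lambda>_. {..<d})" by (auto simp: R_def)
  then have finR: "finite R" and cardR: "card R = d ^ CARD('n)"
    by (auto intro: finite_PiE simp: card_PiE)
  define S where "S = funs.span ((\<lambda>\<beta>. restr (monomial \<beta>)) ` R)"
  have "restr (\<lambda>x. 0) = 0" by (simp add: restr_def fun_eq_iff)
  then have restr_0: "restr (\<lambda>x. 0) \<in> S" "restr 0 \<in> S"
    unfolding S_def zero_fun_def by (simp_all add: funs.span_zero[unfolded zero_fun_def])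
  have mono_S: "restr (monomial \<alpha>) \<in> S" for \<alpha>
  proof (induction "sum \<alpha> UNIV" arbitrary: \<alpha> rule: less_induct)
    case less
    show ?case
    proof (cases "\<alpha> \<in> R")
      case True
      then show ?thesis unfolding S_def by (intro funs.span_base) auto
    next
      case False
      then obtain i where i: "d \<le> \<alpha> i" by (auto simp: R_def not_less)
      obtain Q where Q: "Q \<in> polys_upto e" "\<forall>z\<in>Z. (z $ i) ^ d = Q z" using red by blast
      define \<beta> where "\<beta> = \<alpha>(i := \<alpha> i - d)"
      have \<alpha>_eq: "\<alpha> = (\<lambda>j. \<beta> j + (if j = i then d else 0))" using i by (auto simp: \<beta>_def)
      have deg: "sum \<alpha> UNIV = sum \<beta> UNIV + d" by (subst \<alpha>_eq) (simp add: sum.distrib)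
      have "restr (\<lambda>x. monomial \<beta> x * q x) \<in> S" if "q \<in> polys_upto e" for q
        using that unfolding polys_upto_def
      proof (induction rule: funs.span_induct_alt)
        case base
        then show ?case
          using restr_0 by simp
      next
        case (step c f g)
        then obtain \<gamma> where \<gamma>: "\<gamma> \<in> exponents e" "f = monomial \<gamma>" by auto
        have "restr (monomial (\<lambda>i. \<beta> i + \<gamma> i)) \<in> S"
          using \<gamma>(1) deg \<open>e < d\<close> by (intro less) (auto simp: exponents_def sum.distrib)
        then have "(\<lambda>x. c * restr (monomial (\<lambda>i. \<beta> i + \<gamma> i)) x) + restr (\<lambda>x. monomial \<beta> x * g x) \<in> S"
          using step(2) unfolding S_def by (intro funs.span_add funs.span_scale)
        also have "(\<lambda>x. c * restr (monomial (\<lambda>i. \<beta> i + \<gamma> i)) x) + restr (\<lambda>x. monomial \<beta> x * g x)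
          = restr (\<lambda>x. monomial \<beta> x * ((\<lambda>x. c * f x) + g) x)"
          by (auto simp: fun_eq_iff restr_def \<gamma> monomial_add algebra_simps)
        finally show ?case .
      qed
      moreover have "restr (monomial \<alpha>) = restr (\<lambda>x. monomial \<beta> x * Q x)"
        using Q(2) by (subst \<alpha>_eq) (auto simp: fun_eq_iff restr_def monomial_add monomial_single)
      ultimately show ?thesis using Q(1) by simp
    qed
  qed
  have poly_S: "restr p \<in> S" if p: "real_polynomial_function p" for p
  proof -
    obtain k where "p \<in> polys_upto k" using real_polynomial_function_in_polys_upto[OF p] by blast
    then show ?thesis unfolding polys_upto_def
    proof (induction rule: funs.span_induct_alt)
      case base
      from restr_0 show ?case by simp
    next
      case (step c f g)
      then have "(\<lambda>x. c * restr f x) + restr g \<in> S"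
        using mono_S unfolding S_def by (intro funs.span_add funs.span_scale) auto
      also have "(\<lambda>x. c * restr f x) + restr g = restr ((\<lambda>x. c * f x) + g)"
        by (auto simp: fun_eq_iff restr_def)
      finally show ?case .
    qed
  qed
  define \<delta> :: "real ^ 'n \<Rightarrow> real ^ 'n \<Rightarrow> real" where "\<delta> z = (\<lambda>x. if x = z then 1 else 0)" for z
  have \<delta>_S: "\<delta> z \<in> S" if "z \<in> Z" for z
  proof -
    \<comment> \<open>Interpolation polynomial: it is \<open>1\<close> at \<open>z\<close> and vanishes on the rest of \<open>Z\<close>.\<close>
    define p where "p x = (\<Prod>y\<in>Z - {z}. ((x - y) \<bullet> (z - y)) / ((z - y) \<bullet> (z - y)))" for x
    have lin: "real_polynomial_function (\<lambda>x. x \<bullet> w)" for w :: "real ^ 'n"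
      by (rule real_polynomial_function.intros(1)) (rule bounded_linear_inner_left)
    have "real_polynomial_function (\<lambda>x. ((x - y) \<bullet> (z - y)) / ((z - y) \<bullet> (z - y)))" for y
      unfolding inner_diff_left[of _ y]
      by (rule real_polynomial_function_divide, rule real_polynomial_function_diff[OF lin])
        (rule real_polynomial_function.intros(2))
    then have "real_polynomial_function p"
      unfolding p_def using \<open>finite Z\<close> by (intro real_polynomial_function_prod) simp_all
    moreover have "\<delta> z = restr p"
    proof
      fix x
      have "p x = 0" if "x \<in> Z" "x \<noteq> z"
        unfolding p_def using \<open>finite Z\<close> that by (intro prod_zero bexI[of _ x]) auto
      moreover have "p z = 1" unfolding p_def by (intro prod.neutral) auto
      ultimately show "\<delta> z x = restr p x"
        using \<open>z \<in> Z\<close> by (auto simp: \<delta>_def restr_def)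
    qed
    ultimately show ?thesis using poly_S by simp
  qed
  have inj: "inj_on \<delta> Z" by (auto simp: inj_on_def \<delta>_def fun_eq_iff split: if_splits)
  have indep: "funs.independent (\<delta> ` Z)"
  proof (rule funs.independent_if_scalars_zero)
    show "finite (\<delta> ` Z)" using \<open>finite Z\<close> by simp
    fix f g assume sum0: "(\<Sum>h\<in>\<delta> ` Z. (\<lambda>x. f h * h x)) = 0" and "g \<in> \<delta> ` Z"
    then obtain z where z: "z \<in> Z" "g = \<delta> z" by auto
    have "0 = (\<Sum>y\<in>Z. (\<lambda>x. f (\<delta> y) * \<delta> y x)) z"
      using sum0 by (simp add: sum.reindex[OF inj])
    also have "\<dots> = (\<Sum>y\<in>Z. if y = z then f (\<delta> y) else 0)"
      by (auto simp: sum_fun_apply \<delta>_def intro!: sum.cong)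
    also have "\<dots> = f g" using z \<open>finite Z\<close> by simp
    finally show "f g = 0" by simp
  qed
  have "card (\<delta> ` Z) \<le> card ((\<lambda>\<beta>. restr (monomial \<beta>)) ` R)"
    using funs.independent_span_bound[OF finite_imageI[OF finR] indep] \<delta>_S unfolding S_def by blast
  also have "\<dots> \<le> d ^ CARD('n)" using card_image_le[OF finR] cardR by metis
  finally show ?thesis by (simp add: card_image[OF inj])
qed

text \<open>
  The map \<open>(y, \<epsilon>) \<mapsto> (P y + \<epsilon> R y, \<epsilon>)\<close> has an invertible derivative at \<open>(z, 0)\<close>, so the image of a
  neighbourhood of \<open>(z, 0)\<close> contains \<open>(0, \<epsilon>)\<close> for all small \<open>\<epsilon>\<close>.
\<close>

lemma nondegenerate_zero_persists:
  fixes P R :: "'a::euclidean_space \<Rightarrow> 'a"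
  assumes contP: "continuous_on UNIV P" and contR: "continuous_on UNIV R"
    and diffR: "R differentiable at z"
    and P0: "P z = 0" and der: "(P has_derivative P') (at z)" and inj: "inj P'" and "r > 0"
  shows "\<exists>\<delta>>0. \<forall>\<epsilon>. \<bar>\<epsilon>\<bar> < \<delta> \<longrightarrow> (\<exists>y\<in>ball z r. P y + \<epsilon> *\<^sub>R R y = 0)"
proof -
  define G where "G = (\<lambda>p::'a \<times> real. (P (fst p) + snd p *\<^sub>R R (fst p), snd p))"
  define G' where "G' = (\<lambda>p::'a \<times> real. (P' (fst p) + snd p *\<^sub>R R z, snd p))"
  obtain R' where R': "(R has_derivative R') (at z)"
    using diffR by (auto simp: differentiable_def)
  have linP': "linear P'" using der has_derivative_linear by blast
  obtain Q where Q: "linear Q" "P' \<circ> Q = id"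
    using linear_injective_isomorphism[OF linP' inj] by (auto simp: fun_eq_iff)
  interpret Q: linear Q by fact
  \<comment> \<open>A right inverse of the derivative, obtained by solving for the second component first.\<close>
  define K where "K = (\<lambda>p::'a \<times> real. (Q (fst p - snd p *\<^sub>R R z), snd p))"
  have P'Q: "P' (Q u) = u" for u using Q(2) by (simp add: fun_eq_iff)
  have fstd: "(fst has_derivative fst) (at (z, 0::real))" by (rule has_derivative_fst) simp
  have dP: "((\<lambda>p. P (fst p)) has_derivative (\<lambda>p. P' (fst p))) (at (z, 0::real))"
    by (rule has_derivative_compose[OF fstd, of P P', simplified]) (use der in simp)
  have dR: "((\<lambda>p. R (fst p)) has_derivative (\<lambda>p. R' (fst p))) (at (z, 0::real))"
    by (rule has_derivative_compose[OF fstd, of R R', simplified]) (use R' in simp)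
  have derG: "(G has_derivative G') (at (z, 0))"
    unfolding G_def G'_def by (rule derivative_eq_intros dP dR | simp)+
  have contG: "continuous_on UNIV G"
    unfolding G_def
    by (intro continuous_intros continuous_on_compose2[OF contP] continuous_on_compose2[OF contR]) auto
  have "linear K"
    unfolding K_def by (intro linearI) (auto simp: Q.add Q.diff Q.scale algebra_simps Q.scaleR)
  then have "bounded_linear K" by (rule linear_conv_bounded_linear[THEN iffD1])
  moreover have "G' \<circ> K = id" by (auto simp: fun_eq_iff G'_def K_def P'Q)
  moreover have "(z, 0::real) \<in> interior (ball z r \<times> UNIV)"
    using \<open>r > 0\<close> by (simp add: interior_Times)
  ultimately have "G (z, 0) \<in> interior (G ` (ball z r \<times> UNIV))"
    using sussmann_open_mapping[OF open_UNIV contG UNIV_I derG, of K "ball z r \<times> UNIV"] by auto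
  then obtain \<delta> where \<delta>: "\<delta> > 0" "ball (0, 0) \<delta> \<subseteq> G ` (ball z r \<times> UNIV)"
    by (auto simp: mem_interior G_def P0)
  show ?thesis
  proof (intro exI[of _ \<delta>] conjI allI impI)
    fix \<epsilon> :: real assume "\<bar>\<epsilon>\<bar> < \<delta>"
    then have "(0, \<epsilon>) \<in> ball (0::'a, 0::real) \<delta>" by (simp add: dist_norm norm_Pair)
    then obtain y t where "y \<in> ball z r" "(0, \<epsilon>) = G (y, t)" using \<delta>(2) by blast
    then show "\<exists>y\<in>ball z r. P y + \<epsilon> *\<^sub>R R y = 0" by (auto simp: G_def)
  qed (use \<delta> in auto)
qed

text \<open>
  A weak form of Bezout's theorem. If there were more than \<open>d ^ N\<close> nondegenerate zeros, then for small \<open>\<epsilon>\<close>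
  the system \<open>P_i z + \<epsilon> z_i ^ d = 0\<close> would have a zero near each of them, against
  \<open>card_reduced_zeros\<close>.
\<close>

theorem finite_nondegenerate_zeros:
  fixes P :: "real ^ 'n::finite \<Rightarrow> real ^ 'n"
  assumes poly: "polynomial_function P"
  shows "finite {z. P z = 0 \<and> (\<exists>P'. (P has_derivative P') (at z) \<and> inj P')}" (is "finite ?Z")
proof (rule ccontr)
  assume inf: "infinite ?Z"
  have "\<exists>e. (\<lambda>z. P z $ i) \<in> polys_upto e" for i
  proof (rule real_polynomial_function_in_polys_upto)
    show "real_polynomial_function (\<lambda>z. P z $ i)"
      using poly bounded_linear_vec_nth unfolding polynomial_function_def o_def by blast
  qed
  then obtain ei where ei: "\<And>i. (\<lambda>z. P z $ i) \<in> polys_upto (ei i)" by metis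
  define e where "e = Max (range ei)"
  have Pe: "(\<lambda>z. P z $ i) \<in> polys_upto e" for i
    using ei[of i] polys_upto_mono[of "ei i" e] by (auto simp: e_def)
  \<comment> \<open>Any exponent above \<open>e\<close> makes the perturbing terms dominate all monomials of \<open>P\<close>.\<close>
  define d where "d = Suc e"
  define R :: "real ^ 'n \<Rightarrow> real ^ 'n" where "R z = (\<chi> i. (z $ i) ^ d)" for z
  have polyR: "polynomial_function R"
    unfolding polynomial_function_iff_Basis_inner
  proof
    fix b :: "real ^ 'n" assume "b \<in> Basis"
    then obtain i where b: "b = axis i 1" by (auto simp: Basis_vec_def)
    have "real_polynomial_function (\<lambda>z::real ^ 'n. (z $ i) ^ d)"
      by (rule real_polynomial_function_power, rule real_polynomial_function.intros(1), rule bounded_linear_vec_nth)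
    then show "real_polynomial_function (\<lambda>z. R z \<bullet> b)" by (simp add: b R_def inner_axis)
  qed
  obtain T where T: "finite T" "card T = Suc (d ^ CARD('n))" "T \<subseteq> ?Z"
    using infinite_arbitrarily_large[OF inf, of "Suc (d ^ CARD('n))"] by (elim exE conjE)
  obtain r where r: "r > 0" "\<And>x y. x \<in> T \<Longrightarrow> y \<in> T \<Longrightarrow> x \<noteq> y \<Longrightarrow> 2 * r \<le> dist x y"
  proof -
    define D where "D = insert 1 ((\<lambda>(x, y). dist x y) ` (T \<times> T - Id))"
    have fin: "finite D" using T(1) by (simp add: D_def)
    then have "Min D > 0" by (subst Min_gr_iff) (auto simp: D_def)
    moreover have "Min D \<le> dist x y" if "x \<in> T" "y \<in> T" "x \<noteq> y" for x y
      using fin that by (intro Min_le) (auto simp: D_def)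
    ultimately show ?thesis using that[of "Min D / 2"] by auto
  qed
  have "\<exists>\<delta>>0. \<forall>\<epsilon>. \<bar>\<epsilon>\<bar> < \<delta> \<longrightarrow> (\<exists>y\<in>ball z r. P y + \<epsilon> *\<^sub>R R y = 0)" if zT: "z \<in> T" for z
  proof -
    obtain P' where "P z = 0" "(P has_derivative P') (at z)" "inj P'" using zT T(3) by auto
    then show ?thesis
      using r(1) continuous_on_polymonial_function[OF poly] continuous_on_polymonial_function[OF polyR]
        differentiable_at_polynomial_function[OF polyR]
      by (intro nondegenerate_zero_persists) auto
  qed
  then obtain \<delta> where \<delta>: "\<And>z. z \<in> T \<Longrightarrow> \<delta> z > 0"
      "\<And>z \<epsilon>. z \<in> T \<Longrightarrow> \<bar>\<epsilon>\<bar> < \<delta> z \<Longrightarrow> \<exists>y\<in>ball z r. P y + \<epsilon> *\<^sub>R R y = 0" by metis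
  obtain \<epsilon> where \<epsilon>: "\<epsilon> > 0" "\<And>z. z \<in> T \<Longrightarrow> \<epsilon> < \<delta> z"
  proof -
    have "Min (insert 1 (\<delta> ` T)) > 0" using T(1) \<delta>(1) by (subst Min_gr_iff) auto
    moreover have "Min (insert 1 (\<delta> ` T)) \<le> \<delta> z" if "z \<in> T" for z
      using T(1) that by (intro Min_le) auto
    ultimately show ?thesis using that[of "Min (insert 1 (\<delta> ` T)) / 2"] by force
  qed
  have "\<forall>z\<in>T. \<exists>y\<in>ball z r. P y + \<epsilon> *\<^sub>R R y = 0" using \<delta>(2) \<epsilon> by auto
  then obtain y where y: "\<And>z. z \<in> T \<Longrightarrow> y z \<in> ball z r" "\<And>z. z \<in> T \<Longrightarrow> P (y z) + \<epsilon> *\<^sub>R R (y z) = 0"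
    by metis
  have inj: "inj_on y T"
  proof (rule inj_onI, rule ccontr)
    fix u v assume *: "u \<in> T" "v \<in> T" "y u = y v" "u \<noteq> v"
    have "dist u v \<le> dist u (y u) + dist (y u) v" by (rule dist_triangle)
    also have "\<dots> < r + r" using y(1)[OF *(1)] y(1)[OF *(2)] *(3) by (intro add_strict_mono) (auto simp: dist_commute)
    finally show False using r(2)[OF *(1,2,4)] by simp
  qed
  have "card (y ` T) \<le> d ^ CARD('n)"
  proof (rule card_reduced_zeros)
    show "\<exists>Q\<in>polys_upto e. \<forall>z\<in>y ` T. (z $ i) ^ d = Q z" for i
    proof (intro bexI ballI)
      show "(\<lambda>z. (- 1 / \<epsilon>) * P z $ i) \<in> polys_upto e"
        using Pe[of i] unfolding polys_upto_def by (rule funs.span_scale)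
      fix z assume "z \<in> y ` T"
      then have "P z + \<epsilon> *\<^sub>R R z = 0" using y(2) by auto
      then have "(P z + \<epsilon> *\<^sub>R R z) $ i = 0" by (simp only: zero_index)
      then show "(z $ i) ^ d = (- 1 / \<epsilon>) * P z $ i"
        using \<epsilon>(1) by (simp add: R_def field_simps)
    qed
  qed (use T in \<open>auto simp: d_def\<close>)
  then show False by (simp add: card_image[OF inj] T)
qed

section \<open>Translation probes for Lebesgue null sets\<close>

text \<open>
  Existential quantifiers over points do not preserve measurability in general. Here
  compactness of balls turns the existence of a zero into the existence, in some ball, of arbitrarily
  good approximate zeros, which can be taken from a countable dense set.
\<close>

lemma sets_ex_zero:
  fixes h :: "'c \<Rightarrow> 'z::euclidean_space \<Rightarrow> real"
  assumes cont: "\<And>c. c \<in> space M \<Longrightarrow> continuous_on UNIV (h c)"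
    and meas: "\<And>z. (\<lambda>c. h c z) \<in> borel_measurable M"
  shows "{c \<in> space M. \<exists>z. h c z = 0} \<in> sets M"
proof -
  obtain D :: "'z set" where D: "countable D" "\<And>X. open X \<Longrightarrow> X \<noteq> {} \<Longrightarrow> \<exists>d\<in>D. d \<in> X"
    using countable_dense_setE by blast
  have iff: "(\<exists>z. h c z = 0) \<longleftrightarrow> (\<exists>k::nat. \<forall>n::nat. \<exists>z\<in>D \<inter> ball 0 (real k). \<bar>h c z\<bar> < 1 / Suc n)"
    if c: "c \<in> space M" for c
  proof
    assume "\<exists>z. h c z = 0"
    then obtain z where z: "h c z = 0" by blast
    obtain k :: nat where k: "norm z < real k" using reals_Archimedean2 by blast
    show "\<exists>k::nat. \<forall>n::nat. \<exists>z\<in>D \<inter> ball 0 (real k). \<bar>h c z\<bar> < 1 / Suc n"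
    proof (intro exI allI)
      fix n
      let ?U = "ball 0 (real k) \<inter> {y. \<bar>h c y\<bar> < 1 / Suc n}"
      have "open {y. \<bar>h c y\<bar> < 1 / Suc n}"
        using cont[OF c] by (intro open_Collect_less continuous_intros)
      then have "open ?U" by blast
      moreover have "z \<in> ?U" using z k by simp
      ultimately obtain d where "d \<in> D" "d \<in> ?U" using D(2) by blast
      then show "\<exists>z\<in>D \<inter> ball 0 (real k). \<bar>h c z\<bar> < 1 / Suc n" by blast
    qed
  next
    assume "\<exists>k::nat. \<forall>n::nat. \<exists>z\<in>D \<inter> ball 0 (real k). \<bar>h c z\<bar> < 1 / Suc n"
    then obtain k f where f: "\<And>n. f n \<in> D \<inter> ball 0 (real k)" "\<And>n. \<bar>h c (f n)\<bar> < 1 / Suc n"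
      by metis
    have "\<And>n. f n \<in> cball 0 (real k)" using f(1) by (force simp: less_imp_le)
    then obtain l r where l: "strict_mono r" "(f \<circ> r) \<longlonglongrightarrow> l"
      using compact_cball[of "0::'z" "real k"] unfolding compact_def by metis
    have "isCont (h c) l"
      using cont[OF c] by (simp add: continuous_on_eq_continuous_at)
    then have "(\<lambda>n. h c ((f \<circ> r) n)) \<longlonglongrightarrow> h c l"
      using l(2) by (rule isCont_tendsto_compose)
    moreover have "(\<lambda>n. h c ((f \<circ> r) n)) \<longlonglongrightarrow> 0"
    proof (rule tendsto_rabs_zero_cancel, rule tendsto_sandwich[OF _ _ tendsto_const])
      have "\<bar>h c (f n)\<bar> \<le> 1 / Suc n" for n using f(2)[of n] by simp
      then show "\<forall>\<^sub>F n in sequentially. \<bar>h c ((f \<circ> r) n)\<bar> \<le> ((\<lambda>n. 1 / Suc n) \<circ> r) n" by simp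
      show "((\<lambda>n. 1 / Suc n) \<circ> r) \<longlonglongrightarrow> (0::real)"
        using LIMSEQ_Suc[OF lim_1_over_n] by (intro LIMSEQ_subseq_LIMSEQ l(1)) simp
    qed simp
    ultimately show "\<exists>z. h c z = 0" using LIMSEQ_unique by blast
  qed
  have "{c \<in> space M. \<exists>z. h c z = 0} =
      {c \<in> space M. \<exists>k::nat. \<forall>n::nat. \<exists>z\<in>D \<inter> ball 0 (real k). \<bar>h c z\<bar> < 1 / Suc n}"
    using iff by blast
  also have "\<dots> \<in> sets M"
  proof (intro sets.sets_Collect_countable_Ex sets.sets_Collect_countable_All
      sets.sets_Collect_countable_Ex')
    show "countable (D \<inter> ball 0 (real k))" for k using D(1) by blast
    show "{c \<in> space M. \<bar>h c z\<bar> < 1 / Suc n} \<in> sets M" for z n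
      using meas[of z] by measurable
  qed
  finally show ?thesis .
qed

lemma distr_PiM_lborel_shift:
  fixes k :: "'i \<Rightarrow> real"
  assumes "finite I"
  shows "distr (PiM I (\<lambda>_. lborel)) (PiM I (\<lambda>_. lborel)) (\<lambda>c. \<lambda>i\<in>I. c i + k i)
    = PiM I (\<lambda>_. lborel)" (is "distr ?M ?M ?f = ?M")
proof -
  interpret product_sigma_finite "\<lambda>_::'i. lborel :: real measure" by standard
  have f[measurable]: "?f \<in> ?M \<rightarrow>\<^sub>M ?M" by measurable
  show ?thesis
  proof (rule PiM_eqI)
    fix A :: "'i \<Rightarrow> real set" assume A: "\<And>i. i \<in> I \<Longrightarrow> A i \<in> sets lborel"
    have "?f -` Pi\<^sub>E I A \<inter> space ?M = Pi\<^sub>E I (\<lambda>i. (+) (k i) -` A i)"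
      by (auto simp: space_PiM PiE_iff extensional_def add.commute)
    then have "emeasure (distr ?M ?M ?f) (Pi\<^sub>E I A) = emeasure ?M (Pi\<^sub>E I (\<lambda>i. (+) (k i) -` A i))"
      using A assms by (subst emeasure_distr[OF f]) (auto intro!: sets_PiM_I_finite)
    also have "\<dots> = (\<Prod>i\<in>I. emeasure lborel ((+) (k i) -` A i))"
    proof (rule emeasure_PiM[OF assms])
      fix i assume "i \<in> I"
      then show "(+) (k i) -` A i \<in> sets lborel"
        using A[of i] measurable_sets[of "(+) (k i)" borel borel "A i"] by simp
    qed
    also have "\<dots> = (\<Prod>i\<in>I. emeasure lborel (A i))"
    proof (rule prod.cong[OF refl])
      fix i assume "i \<in> I"
      then have "emeasure (distr lborel borel ((+) (k i))) (A i) = emeasure lborel ((+) (k i) -` A i)"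
        using A[of i] by (subst emeasure_distr) auto
      then show "emeasure lborel ((+) (k i) -` A i) = emeasure lborel (A i)"
        by (simp add: lborel_distr_plus)
    qed
    finally show "emeasure (distr ?M ?M ?f) (Pi\<^sub>E I A) = (\<Prod>i\<in>I. emeasure lborel (A i))" .
  qed (use assms in auto)
qed

text \<open>
  To show that \<open>Q\<close> holds for almost all \<open>c\<close>, it suffices to probe each \<open>c\<close> along the shifts \<open>c + L w\<close>: by
  Fubini some \<open>w\<close> is good for almost all \<open>c\<close>, and the shift by \<open>L w\<close> preserves the measure. The predicate
  \<open>Q\<close> may depend on \<open>w\<close> itself, which accommodates constants that are not among the coefficients.
\<close>

lemma AE_PiM_lborel_probe:
  fixes L :: "'w::euclidean_space \<Rightarrow> 'i \<Rightarrow> real" and Q :: "('i \<Rightarrow> real) \<Rightarrow> 'w \<Rightarrow> bool"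
  defines "M \<equiv> \<lambda>I::'i set. PiM I (\<lambda>_. lborel :: real measure)"
  assumes fin: "finite I"
    and L: "\<And>i. (\<lambda>w. L w i) \<in> borel_measurable borel"
    and Q: "{p \<in> space (M I \<Otimes>\<^sub>M lborel). Q (fst p) (snd p)} \<in> sets (M I \<Otimes>\<^sub>M lborel)"
    and ae: "AE c in M I. AE w in lborel. Q (\<lambda>i\<in>I. c i + L w i) w"
  shows "AE w in lborel. AE c in M I. Q c w"
proof -
  interpret P: product_sigma_finite "\<lambda>_::'i. lborel :: real measure" by standard
  interpret M: sigma_finite_measure "M I" unfolding M_def by (rule P.sigma_finite[OF fin])
  interpret pair_sigma_finite "M I" "lborel :: 'w measure" ..
  define s where "s = (\<lambda>p. (\<lambda>i\<in>I. fst p i + L (snd p) i, snd p))"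
  have L'[measurable]: "(\<lambda>w. L w i) \<in> borel_measurable lborel" for i using L[of i] by simp
  have comp: "(\<lambda>p. fst p i) \<in> borel_measurable (M I \<Otimes>\<^sub>M lborel)" if "i \<in> I" for i
    using measurable_compose[OF measurable_fst measurable_component_singleton[OF that, where M = "\<lambda>_. lborel :: real measure"]]
    unfolding M_def by simp
  have s: "s \<in> M I \<Otimes>\<^sub>M lborel \<rightarrow>\<^sub>M M I \<Otimes>\<^sub>M lborel"
    unfolding s_def
  proof (rule measurable_Pair)
    show "(\<lambda>p. \<lambda>i\<in>I. fst p i + L (snd p) i) \<in> M I \<Otimes>\<^sub>M lborel \<rightarrow>\<^sub>M M I"
      unfolding M_def
    proof (rule measurable_restrict)
      fix i assume "i \<in> I"
      then show "(\<lambda>p. fst p i + L (snd p) i) \<in> Pi\<^sub>M I (\<lambda>_. lborel) \<Otimes>\<^sub>M lborel \<rightarrow>\<^sub>M (lborel :: real measure)"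
        using comp[of i] measurable_compose[OF measurable_snd L'[of i]]
        unfolding M_def by (simp add: borel_measurable_add)
    qed
  qed simp
  have "{p \<in> space (M I \<Otimes>\<^sub>M lborel). Q (fst (s p)) (snd (s p))} = 
      s -` {p \<in> space (M I \<Otimes>\<^sub>M lborel). Q (fst p) (snd p)} \<inter> space (M I \<Otimes>\<^sub>M lborel)"
    using measurable_space[OF s] by auto
  then have "{p \<in> space (M I \<Otimes>\<^sub>M lborel). Q (fst (s p)) (snd (s p))} \<in> sets (M I \<Otimes>\<^sub>M lborel)"
    using measurable_sets[OF s Q] by simp
  then have "AE w in lborel. AE c in M I. Q (\<lambda>i\<in>I. c i + L w i) w"
    using ae AE_commute[of "\<lambda>c w. Q (\<lambda>i\<in>I. c i + L w i) w"] by (simp add: s_def)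
  then show ?thesis
  proof eventually_elim
    case (elim w)
    have f: "(\<lambda>c. \<lambda>i\<in>I. c i + L w i) \<in> M I \<rightarrow>\<^sub>M M I" unfolding M_def by measurable
    have "(\<lambda>c. (c, w)) \<in> M I \<rightarrow>\<^sub>M M I \<Otimes>\<^sub>M lborel" by simp
    from measurable_sets[OF this Q]
    have Qw: "{c \<in> space (M I). Q c w} \<in> sets (M I)"
      by (simp add: vimage_def Int_def space_pair_measure conj_ac)
    have "AE c in distr (M I) (M I) (\<lambda>c. \<lambda>i\<in>I. c i + L w i). Q c w"
      using elim by (subst AE_distr_iff[OF f Qw])
    then show ?case unfolding M_def distr_PiM_lborel_shift[OF fin] .
  qed
qed

section \<open>Generic members of an affine family of polynomial systems\<close>

text \<open>
  Polynomiality of the gradient gives continuity of the derivative in point and direction, which is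
  what \<open>sets_ex_zero\<close> needs, and makes Lagrange systems polynomial.
\<close>

lemma real_polynomial_function_gradient:
  fixes f :: "'a::euclidean_space \<Rightarrow> real"
  assumes "real_polynomial_function f"
  shows "\<exists>G. polynomial_function G \<and> (\<forall>x. GDERIV f x :> G x)"
  using assms
proof induction
  case (linear f)
  interpret f: bounded_linear f by fact
  have "f h = h \<bullet> (\<Sum>b\<in>Basis. f b *\<^sub>R b)" for h
  proof -
    have "f h = f (\<Sum>b\<in>Basis. (h \<bullet> b) *\<^sub>R b)" by (simp add: euclidean_representation)
    also have "\<dots> = (\<Sum>b\<in>Basis. (h \<bullet> b) * f b)" by (simp only: f.sum f.scaleR) simp
    finally show ?thesis by (simp add: inner_sum_right mult.commute)
  qed
  then have "f = (\<lambda>h. h \<bullet> (\<Sum>b\<in>Basis. f b *\<^sub>R b))" by blast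
  then have "GDERIV f x :> (\<Sum>b\<in>Basis. f b *\<^sub>R b)" for x
    unfolding gderiv_def using bounded_linear_imp_has_derivative[OF linear] by metis
  then show ?case by (intro exI[of _ "\<lambda>x. \<Sum>b\<in>Basis. f b *\<^sub>R b"]) simp
next
  case (const c)
  then show ?case using GDERIV_const by (intro exI[of _ "\<lambda>x. 0"]) auto
next
  case (add f g)
  then obtain F G where "polynomial_function F" "polynomial_function G"
    "\<And>x. GDERIV f x :> F x" "\<And>x. GDERIV g x :> G x" by blast
  then show ?case
    by (intro exI[of _ "\<lambda>x. F x + G x"] conjI allI polynomial_function_add GDERIV_add)
next
  case (mult f g)
  then obtain F G where FG: "polynomial_function F" "polynomial_function G"
    "\<And>x. GDERIV f x :> F x" "\<And>x. GDERIV g x :> G x" by blast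
  moreover have "polynomial_function f" "polynomial_function g"
    using mult.hyps by (simp_all add: real_polynomial_function_eq)
  ultimately show ?case
    by (intro exI[of _ "\<lambda>x. f x *\<^sub>R G x + g x *\<^sub>R F x"] conjI allI polynomial_function_add
        polynomial_function_mult GDERIV_mult)
qed

lemma polynomial_function_C1:
  fixes f :: "'a::euclidean_space \<Rightarrow> 'b::euclidean_space"
  assumes "polynomial_function f"
  shows "\<exists>f'. (\<forall>x. (f has_derivative f' x) (at x)) \<and> continuous_on UNIV (\<lambda>p. f' (fst p) (snd p))"
proof -
  have "\<forall>b\<in>Basis. \<exists>G. polynomial_function G \<and> (\<forall>x. GDERIV (\<lambda>x. f x \<bullet> b) x :> G x)"
    using assms real_polynomial_function_gradient unfolding polynomial_function_iff_Basis_inner by blast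
  then obtain G where G: "\<And>b. b \<in> Basis \<Longrightarrow> polynomial_function (G b)"
      "\<And>b x. b \<in> Basis \<Longrightarrow> ((\<lambda>x. f x \<bullet> b) has_derivative (\<lambda>v. v \<bullet> G b x)) (at x)"
    unfolding gderiv_def by metis
  have "((\<lambda>x. \<Sum>b\<in>Basis. (f x \<bullet> b) *\<^sub>R b) has_derivative (\<lambda>v. \<Sum>b\<in>Basis. (v \<bullet> G b x) *\<^sub>R b)) (at x)" for x
    by (intro has_derivative_sum has_derivative_scaleR_left G)
  then have "(f has_derivative (\<lambda>v. \<Sum>b\<in>Basis. (v \<bullet> G b x) *\<^sub>R b)) (at x)" for x
    by (simp add: euclidean_representation)
  moreover have "continuous_on UNIV (\<lambda>p::'a \<times> 'a. G b (fst p))" if "b \<in> Basis" for b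
    by (rule continuous_on_compose2[OF continuous_on_polymonial_function[OF G(1)[OF that]]])
      (auto intro!: continuous_intros)
  then have "continuous_on UNIV (\<lambda>p. \<Sum>b\<in>Basis. (snd p \<bullet> G b (fst p)) *\<^sub>R b)"
    by (intro continuous_intros)
  ultimately show ?thesis by (intro exI[of _ "\<lambda>x v. \<Sum>b\<in>Basis. (v \<bullet> G b x) *\<^sub>R b"]) auto
qed

lemma AE_regular_value:
  fixes f :: "real ^ 'n::{finite,wellorder} \<Rightarrow> real ^ 'n::{finite,wellorder}"
  assumes "\<And>x. (f has_derivative f' x) (at x)"
  shows "AE w in lborel. \<forall>x. f x = w \<longrightarrow> inj (f' x)"
proof -
  define S where "S = {x. \<not> inj (f' x)}"
  have "negligible (f ` S)"
  proof (rule baby_Sard)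
    show "(f has_derivative f' x) (at x within S)" for x
      using assms has_derivative_at_withinI by blast
    fix x assume "x \<in> S"
    moreover have "(*v) (matrix (f' x)) = f' x"
      using matrix_vector_mul(3)[OF has_derivative_bounded_linear[OF assms[of x]]] by simp
    ultimately show "rank (matrix (f' x)) < CARD('n)"
      by (simp add: S_def less_rank_noninjective)
  qed simp
  then have "AE w in lebesgue. w \<notin> f ` S"
    unfolding negligible_iff_null_sets by (rule AE_not_in)
  then have "AE w in lborel. w \<notin> f ` S" by (simp add: AE_completion_iff)
  then show ?thesis by eventually_elim (auto simp: S_def)
qed

text \<open>
  The assumption \<open>shift\<close> says that moving the coefficients by \<open>L w\<close> and adding the constant \<open>D w\<close> together
  translate the system by exactly \<open>w\<close>. Sard's theorem then makes all zeros nondegenerate for almost all \<open>w\<close>.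
  The map \<open>D\<close> serves the equations whose constant term is not a coefficient: for them one fixed
  generic constant is chosen, and the coefficients \<open>c\<close> remain generic.
\<close>

theorem AE_affine_family_finite_zeros:
  fixes \<phi>0 :: "real ^ 'n::{finite,wellorder} \<Rightarrow> real ^ 'n::{finite,wellorder}" and \<phi> :: "'i \<Rightarrow> real ^ 'n::{finite,wellorder} \<Rightarrow> real ^ 'n::{finite,wellorder}"
    and L :: "real ^ 'n::{finite,wellorder} \<Rightarrow> 'i \<Rightarrow> real" and D :: "real ^ 'n::{finite,wellorder} \<Rightarrow> real ^ 'n::{finite,wellorder}"
  assumes fin: "finite I"
    and poly0: "polynomial_function \<phi>0" and poly: "\<And>i. i \<in> I \<Longrightarrow> polynomial_function (\<phi> i)"
    and L: "\<And>i. (\<lambda>w. L w i) \<in> borel_measurable borel" and D: "D \<in> borel_measurable borel"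
    and shift: "\<And>w z. (\<Sum>i\<in>I. L w i *\<^sub>R \<phi> i z) + D w = w"
  shows "\<exists>w. AE c in PiM I (\<lambda>_. lborel). finite {z. \<phi>0 z + (\<Sum>i\<in>I. c i *\<^sub>R \<phi> i z) + D w = 0}"
proof -
  let ?M = "PiM I (\<lambda>_. lborel :: real measure)"
  define \<Phi> where "\<Phi> c z = \<phi>0 z + (\<Sum>i\<in>I. c i *\<^sub>R \<phi> i z)" for c z
  obtain \<phi>0' where \<phi>0': "\<And>x. (\<phi>0 has_derivative \<phi>0' x) (at x)"
      "continuous_on UNIV (\<lambda>p. \<phi>0' (fst p) (snd p))"
    using polynomial_function_C1[OF poly0] by blast
  have "\<forall>i\<in>I. \<exists>f'. (\<forall>x. (\<phi> i has_derivative f' x) (at x)) \<and> continuous_on UNIV (\<lambda>p. f' (fst p) (snd p))"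
    using polynomial_function_C1[OF poly] by blast
  then obtain \<phi>' where \<phi>': "\<And>i x. i \<in> I \<Longrightarrow> (\<phi> i has_derivative \<phi>' i x) (at x)"
      "\<And>i. i \<in> I \<Longrightarrow> continuous_on UNIV (\<lambda>p. \<phi>' i (fst p) (snd p))" by metis
  define \<Phi>' where "\<Phi>' c z v = \<phi>0' z v + (\<Sum>i\<in>I. c i *\<^sub>R \<phi>' i z v)" for c z v
  have der: "(\<Phi> c has_derivative \<Phi>' c z) (at z)" for c z
    unfolding \<Phi>_def \<Phi>'_def
    by (intro has_derivative_add has_derivative_sum has_derivative_scaleR_right \<phi>0' \<phi>')
  have polyPhi: "polynomial_function (\<lambda>z. \<Phi> c z + D w)" for c w
    unfolding \<Phi>_def
    by (intro polynomial_function_add polynomial_function_sum polynomial_function_cmul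
        polynomial_function_const poly poly0 fin)
  define Q where "Q c w \<longleftrightarrow> (\<forall>z. \<Phi> c z + D w = 0 \<longrightarrow> inj (\<Phi>' c z))" for c w
  \<comment> \<open>The zeros of a continuous function on pairs (point, direction) encode degenerate zeros of the system.\<close>
  have Q_iff: "Q c w \<longleftrightarrow> \<not> (\<exists>p. norm (\<Phi> c (fst p) + D w) + norm (\<Phi>' c (fst p) (snd p)) + \<bar>norm (snd p) - 1\<bar> = 0)"
    for c w
  proof -
    have lin: "linear (\<Phi>' c z)" for z using der has_derivative_linear by blast
    have "inj (\<Phi>' c z) \<longleftrightarrow> \<not> (\<exists>v. norm (\<Phi>' c z v) + \<bar>norm v - 1\<bar> = 0)" for z
    proof
      assume "inj (\<Phi>' c z)"
      then have "v = 0" if "\<Phi>' c z v = 0" for v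
        using that linear_injective_0[OF lin] by blast
      then show "\<not> (\<exists>v. norm (\<Phi>' c z v) + \<bar>norm v - 1\<bar> = 0)"
        by (metis abs_ge_zero add_nonneg_eq_0_iff eq_iff_diff_eq_0 norm_eq_zero norm_ge_zero
            abs_eq_0 zero_neq_one)
    next
      assume *: "\<not> (\<exists>v. norm (\<Phi>' c z v) + \<bar>norm v - 1\<bar> = 0)"
      show "inj (\<Phi>' c z)"
      proof (subst linear_injective_0[OF lin], intro allI impI, rule ccontr)
        fix v assume "\<Phi>' c z v = 0" "v \<noteq> 0"
        then have "\<Phi>' c z (v /\<^sub>R norm v) = 0" "norm (v /\<^sub>R norm v) = 1"
          by (simp_all add: linear_scale[OF lin])
        then have "norm (\<Phi>' c z (v /\<^sub>R norm v)) + \<bar>norm (v /\<^sub>R norm v) - 1\<bar> = 0"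
          by (simp only: norm_zero)
        then show False using * by blast
      qed
    qed
    then show ?thesis unfolding Q_def by (auto simp: add_nonneg_eq_0_iff)
  qed
  have comp: "(\<lambda>q. fst q i) \<in> borel_measurable (?M \<Otimes>\<^sub>M lborel)" if "i \<in> I" for i
    using measurable_compose[OF measurable_fst
        measurable_component_singleton[OF that, where M = "\<lambda>_. lborel :: real measure"]] by simp
  have Dm: "(\<lambda>q. D (snd q)) \<in> borel_measurable (?M \<Otimes>\<^sub>M lborel)"
    using D by (intro measurable_compose[OF measurable_snd]) simp
  have bad: "{q \<in> space (?M \<Otimes>\<^sub>M lborel). \<exists>p. norm (\<Phi> (fst q) (fst p) + D (snd q))
      + norm (\<Phi>' (fst q) (fst p) (snd p)) + \<bar>norm (snd p) - 1\<bar> = 0} \<in> sets (?M \<Otimes>\<^sub>M lborel)"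
  proof (rule sets_ex_zero)
    fix q :: "('i \<Rightarrow> real) \<times> (real ^ 'n::{finite,wellorder})"
    have "continuous_on UNIV (\<lambda>p. \<Phi> (fst q) (fst p) :: real ^ 'n::{finite,wellorder})" 
      using der has_derivative_continuous_on[of UNIV "\<Phi> (fst q)" "\<Phi>' (fst q)"]
      by (auto intro!: continuous_on_compose2[of UNIV "\<Phi> (fst q)"] continuous_intros)
    moreover have "continuous_on UNIV (\<lambda>p. \<Phi>' (fst q) (fst p) (snd p))"
      unfolding \<Phi>'_def by (intro continuous_intros \<phi>0' \<phi>')
    ultimately show "continuous_on UNIV (\<lambda>p. norm (\<Phi> (fst q) (fst p) + D (snd q))
      + norm (\<Phi>' (fst q) (fst p) (snd p)) + \<bar>norm (snd p) - 1\<bar>)"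
      by (intro continuous_intros)
  next
    fix p :: "(real ^ 'n::{finite,wellorder}) \<times> (real ^ 'n::{finite,wellorder})"
    show "(\<lambda>q. norm (\<Phi> (fst q) (fst p) + D (snd q)) + norm (\<Phi>' (fst q) (fst p) (snd p))
      + \<bar>norm (snd p) - 1\<bar>) \<in> borel_measurable (?M \<Otimes>\<^sub>M lborel)"
      unfolding \<Phi>_def \<Phi>'_def
      by (intro borel_measurable_add borel_measurable_norm measurable_compose[OF _ borel_measurable_norm]
          borel_measurable_sum borel_measurable_scaleR borel_measurable_const comp Dm)
  qed
  have Q_sets: "{q \<in> space (?M \<Otimes>\<^sub>M lborel). Q (fst q) (snd q)} \<in> sets (?M \<Otimes>\<^sub>M lborel)"
    unfolding Q_iff using sets.sets_Collect_neg[OF bad] by simp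
  have "AE w in lborel. Q (\<lambda>i\<in>I. c i + L w i) w" for c
  proof -
    have "AE w in lborel. \<forall>z. - \<Phi> c z = w \<longrightarrow> inj (\<lambda>v. - \<Phi>' c z v)"
      by (rule AE_regular_value) (intro has_derivative_minus der)
    then show ?thesis
    proof eventually_elim
      case (elim w)
      let ?c = "\<lambda>i\<in>I. c i + L w i"
      have eq: "\<Phi> ?c z + D w = \<Phi> c z + w" for z
        using shift[of w z] by (simp add: \<Phi>_def algebra_simps sum.distrib)
      then have "\<Phi> ?c = (\<lambda>z. \<Phi> c z + (w - D w))" by (simp add: fun_eq_iff algebra_simps)
      then have "(\<Phi> ?c has_derivative \<Phi>' c z) (at z)" for z
        using has_derivative_add[OF der[of c z] has_derivative_const[of "w - D w"]] by simp
      then have "\<Phi>' ?c z = \<Phi>' c z" for z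
        using der has_derivative_unique by blast
      moreover have "inj (\<Phi>' c z)" if "\<Phi> c z + w = 0" for z
      proof -
        have "- \<Phi> c z = w" using that by (simp add: add_eq_0_iff)
        then have "inj (\<lambda>v. - \<Phi>' c z v)" using elim by blast
        then show ?thesis by (simp add: inj_def)
      qed
      ultimately show ?case unfolding Q_def eq by simp
    qed
  qed
  then have "AE c in ?M. AE w in lborel. Q (\<lambda>i\<in>I. c i + L w i) w" by simp
  then have "AE w in lborel. AE c in ?M. Q c w"
    by (rule AE_PiM_lborel_probe[OF fin L Q_sets])
  then obtain w where "AE c in ?M. Q c w"
    using eventually_happens'[of "ae_filter lborel"] by (auto simp: ae_filter_eq_bot_iff)
  then have "AE c in ?M. finite {z. \<Phi> c z + D w = 0}"
  proof eventually_elim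
    case (elim c)
    have "{z. \<Phi> c z + D w = 0} \<subseteq>
      {z. \<Phi> c z + D w = 0 \<and> (\<exists>P'. ((\<lambda>z. \<Phi> c z + D w) has_derivative P') (at z) \<and> inj P')}"
      using elim has_derivative_add[OF der has_derivative_const]
      unfolding Q_def by fastforce
    then show ?case using finite_nondegenerate_zeros[OF polyPhi] finite_subset by blast
  qed
  then show ?thesis unfolding \<Phi>_def by blast
qed

text \<open>
  A linear isomorphism carries the result from coordinate vectors over to any Euclidean space of the
  same dimension, such as the space of pairs of points and multipliers below.
\<close>

corollary AE_affine_family_finite_zeros_euclidean:
  fixes \<phi>0 :: "'a::euclidean_space \<Rightarrow> 'a" and \<phi> :: "'i \<Rightarrow> 'a \<Rightarrow> 'a"
    and L :: "'a \<Rightarrow> 'i \<Rightarrow> real" and D :: "'a \<Rightarrow> 'a"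
  assumes dim: "DIM('a) = CARD('m::{finite,wellorder})"
    and fin: "finite I"
    and poly0: "polynomial_function \<phi>0" and poly: "\<And>i. i \<in> I \<Longrightarrow> polynomial_function (\<phi> i)"
    and L: "\<And>i. (\<lambda>w. L w i) \<in> borel_measurable borel" and D: "D \<in> borel_measurable borel"
    and shift: "\<And>w z. (\<Sum>i\<in>I. L w i *\<^sub>R \<phi> i z) + D w = w"
  shows "\<exists>w. AE c in PiM I (\<lambda>_. lborel). finite {z. \<phi>0 z + (\<Sum>i\<in>I. c i *\<^sub>R \<phi> i z) + D w = 0}"
proof -
  obtain T :: "real ^ 'm::{finite,wellorder} \<Rightarrow> 'a" and S where TS: "linear T" "linear S" "\<And>z. S (T z) = z" "\<And>z. T (S z) = z"
  proof (rule isomorphisms_UNIV_UNIV[where 'M = "real ^ 'm::{finite,wellorder}" and 'N = 'a])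
    show "DIM(real ^ 'm::{finite,wellorder}) = DIM('a)" using dim by simp
  qed (rule that, auto)
  interpret S: linear S by (rule TS)
  have bT: "bounded_linear T" and bS: "bounded_linear S"
    using TS by (auto simp: linear_conv_bounded_linear)
  have conj: "polynomial_function (\<lambda>z. S (f (T z)))" if "polynomial_function f" for f
    using polynomial_function_compose[OF polynomial_function_compose[OF
          polynomial_function_bounded_linear[OF bT] that] polynomial_function_bounded_linear[OF bS]]
    by (simp add: o_def)
  have meas: "T \<in> borel_measurable borel" "S \<in> borel_measurable borel"
    using bT bS by (auto intro!: borel_measurable_continuous_onI linear_continuous_on)
  have "\<exists>w. AE c in PiM I (\<lambda>_. lborel). finite {z. S (\<phi>0 (T z))
      + (\<Sum>i\<in>I. c i *\<^sub>R S (\<phi> i (T z))) + S (D (T w)) = 0}"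
  proof (rule AE_affine_family_finite_zeros[where L = "\<lambda>w. L (T w)"])
    show "(\<lambda>w. L (T w) i) \<in> borel_measurable borel" for i
      by (rule measurable_compose[OF meas(1) L])
    show "(\<lambda>w. S (D (T w))) \<in> borel_measurable borel"
      by (rule measurable_compose[OF measurable_compose[OF meas(1) D] meas(2)])
    show "(\<Sum>i\<in>I. L (T w) i *\<^sub>R S (\<phi> i (T z))) + S (D (T w)) = w" for w z
    proof -
      have "(\<Sum>i\<in>I. L (T w) i *\<^sub>R S (\<phi> i (T z))) + S (D (T w)) =
          S ((\<Sum>i\<in>I. L (T w) i *\<^sub>R \<phi> i (T z)) + D (T w))"
        by (simp add: S.add S.sum S.scaleR)
      then show ?thesis by (simp add: shift TS)
    qed
  qed (use fin poly0 poly conj in auto)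
  then obtain w where "AE c in PiM I (\<lambda>_. lborel). finite {z. S (\<phi>0 (T z))
      + (\<Sum>i\<in>I. c i *\<^sub>R S (\<phi> i (T z))) + S (D (T w)) = 0}" by blast
  then have "AE c in PiM I (\<lambda>_. lborel). finite {z. \<phi>0 z + (\<Sum>i\<in>I. c i *\<^sub>R \<phi> i z) + D (T w) = 0}"
  proof eventually_elim
    case (elim c)
    have "{z. \<phi>0 z + (\<Sum>i\<in>I. c i *\<^sub>R \<phi> i z) + D (T w) = 0} \<subseteq> T ` {z. S (\<phi>0 (T z))
      + (\<Sum>i\<in>I. c i *\<^sub>R S (\<phi> i (T z))) + S (D (T w)) = 0}"
    proof
      fix z assume "z \<in> {z. \<phi>0 z + (\<Sum>i\<in>I. c i *\<^sub>R \<phi> i z) + D (T w) = 0}"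
      then have "S (\<phi>0 z + (\<Sum>i\<in>I. c i *\<^sub>R \<phi> i z) + D (T w)) = 0" by (simp add: S.zero)
      then show "z \<in> T ` {z. S (\<phi>0 (T z))
          + (\<Sum>i\<in>I. c i *\<^sub>R S (\<phi> i (T z))) + S (D (T w)) = 0}"
        by (intro image_eqI[of _ _ "S z"]) (auto simp: TS S.add S.sum S.scaleR)
    qed
    then show ?case using elim finite_subset by blast
  qed
  then show ?thesis by blast
qed

section \<open>Lagrange multipliers under linear independence of the active gradients\<close>

text \<open>
  The vector \<open>w j\<close> is the component of \<open>v j\<close> orthogonal to the other vectors, rescaled.
\<close>

lemma dual_basis_exists:
  fixes v :: "'j \<Rightarrow> 'a::euclidean_space"
  assumes inj: "inj_on v J" and indep: "independent (v ` J)"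
  shows "\<exists>w. \<forall>i\<in>J. \<forall>j\<in>J. v i \<bullet> w j = (if i = j then 1 else 0)"
proof -
  have "\<exists>w. \<forall>i\<in>J. v i \<bullet> w = (if i = j then 1 else 0)" if j: "j \<in> J" for j
  proof -
    let ?S = "v ` (J - {j})"
    obtain y z where yz: "y \<in> span ?S" "\<And>u. u \<in> span ?S \<Longrightarrow> orthogonal z u" "v j = y + z"
      using orthogonal_subspace_decomp_exists[of ?S "v j"] by metis
    have "v ` J - {v j} = ?S" using inj j by (auto simp: inj_on_def)
    then have "v j \<notin> span ?S" using indep j unfolding dependent_def by auto
    then have "z \<noteq> 0" using yz by auto
    have *: "v i \<bullet> z = (if i = j then z \<bullet> z else 0)" if "i \<in> J" for i
    proof (cases "i = j")
      case True
      then show ?thesis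
        using yz(2)[OF yz(1)] by (simp add: yz(3) inner_add_left inner_add_right orthogonal_def inner_commute)
    next
      case False
      then have "v i \<in> span ?S" using that by (intro span_base) auto
      then have "z \<bullet> v i = 0" using yz(2) by (simp add: orthogonal_def)
    then show ?thesis using False by (simp add: inner_commute)
    qed
    show ?thesis
      using * \<open>z \<noteq> 0\<close> by (intro exI[of _ "z /\<^sub>R (z \<bullet> z)"]) auto
  qed
  then show ?thesis by metis
qed

text \<open>
  With \<open>w\<close> dual to the active gradients, the map \<open>H y = (y - x) + \<Sum>(g_j y - (y - x) \<bullet> v_j) w_j\<close> straightens all
  active constraints at once: \<open>v_i \<bullet> H y = g_i y\<close>, and the derivative of \<open>H\<close> at \<open>x\<close> is the identity. Solving
  \<open>H y = t d\<close> for small \<open>t > 0\<close> yields a feasible point \<open>y = x + t d + o(t)\<close>, so minimality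
  of \<open>x\<close> gives \<open>d \<bullet> q \<ge> 0\<close>.
\<close>

lemma feasible_direction_nonneg:
  fixes g :: "nat \<Rightarrow> real ^ 'n \<Rightarrow> real" and v :: "nat \<Rightarrow> real ^ 'n"
  assumes fin: "finite (\<E> \<union> \<I>)"
    and cont: "\<And>j. j \<in> \<E> \<union> \<I> \<Longrightarrow> continuous_on UNIV (g j)"
    and grad: "\<And>j. j \<in> \<E> \<union> \<I> \<Longrightarrow> GDERIV (g j) x :> v j"
    and x: "x \<in> feasible_set \<E> \<I> g"
    and min: "\<And>y. y \<in> feasible_set \<E> \<I> g \<Longrightarrow> (y - x) \<bullet> q \<ge> 0"
    and J: "J = {j \<in> \<E> \<union> \<I>. g j x = 0}"
    and w: "\<And>i j. i \<in> J \<Longrightarrow> j \<in> J \<Longrightarrow> v i \<bullet> w j = (if i = j then 1 else 0)"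
    and d: "\<And>j. j \<in> \<E> \<Longrightarrow> v j \<bullet> d = 0" "\<And>j. j \<in> J \<Longrightarrow> v j \<bullet> d \<ge> 0"
  shows "d \<bullet> q \<ge> 0"
proof (rule ccontr)
  assume "\<not> d \<bullet> q \<ge> 0"
  then have dq: "d \<bullet> q < 0" by simp
  have finJ: "finite J" using fin J by simp
  define H where "H y = (y - x) + (\<Sum>j\<in>J. (g j y - (y - x) \<bullet> v j) *\<^sub>R w j)" for y
  have gx: "g j x = 0" if "j \<in> J" for j using that J by simp
  have Hx: "H x = 0" by (simp add: H_def gx)
  have vH: "v i \<bullet> H y = g i y" if "i \<in> J" for i y
  proof -
    have "v i \<bullet> H y = v i \<bullet> (y - x) + (\<Sum>j\<in>J. (g j y - (y - x) \<bullet> v j) * (v i \<bullet> w j))"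
      by (simp add: H_def inner_add_right inner_sum_right)
    also have "(\<Sum>j\<in>J. (g j y - (y - x) \<bullet> v j) * (v i \<bullet> w j)) =
        (\<Sum>j\<in>J. if i = j then g j y - (y - x) \<bullet> v j else 0)"
      using that by (intro sum.cong) (auto simp: w)
    also have "\<dots> = g i y - (y - x) \<bullet> v i" using finJ that by simp
    finally show ?thesis by (simp add: inner_commute)
  qed
  have derH: "(H has_derivative (\<lambda>h. h)) (at x)"
  proof -
    have "((\<lambda>y. g j y - (y - x) \<bullet> v j) has_derivative (\<lambda>h. h \<bullet> v j - h \<bullet> v j)) (at x)" if "j \<in> J" for j
      using grad[of j] that J unfolding gderiv_def
      by (intro has_derivative_diff) (auto intro!: derivative_eq_intros)
    then have "((\<lambda>y. (y - x) + (\<Sum>j\<in>J. (g j y - (y - x) \<bullet> v j) *\<^sub>R w j)) has_derivative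
        (\<lambda>h. h + (\<Sum>j\<in>J. (h \<bullet> v j - h \<bullet> v j) *\<^sub>R w j))) (at x)"
      by (intro has_derivative_add has_derivative_sum has_derivative_scaleR_left)
        (auto intro!: derivative_eq_intros)
    then show ?thesis by (simp add: H_def[abs_def])
  qed
  have contH: "continuous_on UNIV H"
    unfolding H_def using cont J by (intro continuous_intros) auto
  \<comment> \<open>With this value the error term in the last estimate stays below the first-order decrease \<open>- (d \<bullet> q)\<close>.\<close>
  define \<eta> where "\<eta> = min (1/2) (- (d \<bullet> q) / (2 * norm d * norm q + 1))"
  have den: "2 * norm d * norm q + 1 > 0" by (simp add: add_nonneg_pos)
  have \<eta>: "\<eta> > 0" "\<eta> \<le> 1/2"
    using divide_pos_pos[OF _ den, of "- (d \<bullet> q)"] dq unfolding \<eta>_def by (simp, intro min.cobounded1)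
  have \<eta>dq: "2 * \<eta> * norm d * norm q < - (d \<bullet> q)"
  proof -
    have "2 * \<eta> * norm d * norm q < \<eta> * (2 * norm d * norm q + 1)"
      using \<eta>(1) by (simp add: algebra_simps)
    also have "\<dots> \<le> (- (d \<bullet> q) / (2 * norm d * norm q + 1)) * (2 * norm d * norm q + 1)"
      using den by (intro mult_right_mono) (auto simp: \<eta>_def)
    also have "\<dots> = - (d \<bullet> q)" using den by simp
    finally show ?thesis .
  qed
  obtain r1 where r1: "r1 > 0" "\<And>y. norm (y - x) < r1 \<Longrightarrow> norm (H y - (y - x)) \<le> \<eta> * norm (y - x)"
    using derH \<eta>(1) unfolding has_derivative_at_alt Hx by (metis Hx diff_zero)
  obtain r2 where r2: "r2 > 0" "\<And>y j. y \<in> ball x r2 \<Longrightarrow> j \<in> \<I> - J \<Longrightarrow> g j y > 0"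
  proof -
    have "open (\<Inter>j\<in>\<I> - J. {y. g j y > 0})"
      using fin cont by (intro open_INT ballI open_Collect_less continuous_intros) auto
    moreover have "x \<in> (\<Inter>j\<in>\<I> - J. {y. g j y > 0})"
      using x J by (force simp: feasible_set_def)
    ultimately obtain e where "e > 0" "ball x e \<subseteq> (\<Inter>j\<in>\<I> - J. {y. g j y > 0})"
      using openE by blast
    then show ?thesis using that[of e] by blast
  qed
  define r where "r = min r1 r2"
  have "r > 0" using r1 r2 by (simp add: r_def)
  then have "H x \<in> interior (H ` ball x r)"
    using sussmann_open_mapping[OF open_UNIV contH UNIV_I derH, of "\<lambda>h. h" "ball x r"]
    by (auto simp: interior_open bounded_linear_ident fun_eq_iff)
  then obtain \<delta> where \<delta>: "\<delta> > 0" "ball 0 \<delta> \<subseteq> H ` ball x r"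
    by (auto simp: mem_interior Hx)
  define t where "t = \<delta> / (2 * (norm d + 1))"
  have t: "t > 0" using \<delta>(1) by (simp add: t_def add_nonneg_pos)
  have "norm (t *\<^sub>R d) < \<delta>"
  proof -
    have "norm (t *\<^sub>R d) \<le> t * (norm d + 1)" using t by (simp add: algebra_simps)
    also have "\<dots> = (\<delta> * (norm d + 1)) / (2 * (norm d + 1))" by (simp add: t_def)
    also have "\<dots> = \<delta> / 2"
    proof (rule mult_divide_mult_cancel_right)
      show "norm d + 1 \<noteq> 0" using norm_ge_zero[of d] by linarith
    qed
    finally show ?thesis using \<delta>(1) by simp
  qed
  then have "t *\<^sub>R d \<in> ball 0 \<delta>" by simp
  then obtain y where y: "y \<in> ball x r" "t *\<^sub>R d = H y" using \<delta>(2) by blast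
  have "g j y = t * (v j \<bullet> d)" if "j \<in> J" for j
    using vH[OF that, of y] by (simp flip: y(2))
  then have "y \<in> feasible_set \<E> \<I> g"
    using d t x y(1) r2(2)[of y] J unfolding feasible_set_def
    by (auto simp: r_def) (metis (no_types, lifting) Diff_iff UnCI less_eq_real_def mem_Collect_eq mult_nonneg_nonneg)
  then have "0 \<le> (y - x) \<bullet> q" by (rule min)
  also have "(y - x) \<bullet> q = t * (d \<bullet> q) + (y - x - t *\<^sub>R d) \<bullet> q"
    by (simp add: inner_diff_left)
  also have "(y - x - t *\<^sub>R d) \<bullet> q \<le> (2 * \<eta> * (t * norm d)) * norm q"
  proof -
    have ny: "norm (y - x) < r1" using y(1) by (simp add: r_def dist_norm norm_minus_commute)
    have 1: "norm (y - x - t *\<^sub>R d) \<le> \<eta> * norm (y - x)"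
      using r1(2)[OF ny] by (simp add: norm_minus_commute flip: y(2))
    have "norm (y - x) \<le> norm (y - x - t *\<^sub>R d) + norm (t *\<^sub>R d)"
      using norm_triangle_ineq[of "y - x - t *\<^sub>R d" "t *\<^sub>R d"] by simp
    also have "\<dots> \<le> 1/2 * norm (y - x) + t * norm d"
      using 1 mult_right_mono[OF \<eta>(2), of "norm (y - x)"] t by simp
    finally have "norm (y - x) \<le> 2 * (t * norm d)" by simp
    then have "norm (y - x - t *\<^sub>R d) \<le> \<eta> * (2 * (t * norm d))"
      using 1 \<eta>(1) by (meson less_imp_le mult_left_mono order_trans)
    then have "norm (y - x - t *\<^sub>R d) * norm q \<le> (2 * \<eta> * (t * norm d)) * norm q"
      by (intro mult_right_mono) (auto simp: algebra_simps)
    then show ?thesis using norm_cauchy_schwarz order_trans by blast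
  qed
  also have "t * (d \<bullet> q) + (2 * \<eta> * (t * norm d)) * norm q = t * (d \<bullet> q + 2 * \<eta> * norm d * norm q)"
    by (simp add: algebra_simps)
  also have "\<dots> < 0" using \<eta>dq t by (simp add: mult_pos_neg)
  finally show False by simp
qed

text \<open>
  Two kinds of feasible directions suffice. The negative of the component of \<open>q\<close> orthogonal to the active
  gradients shows that \<open>q\<close> lies in their span; the dual vector \<open>w i\<close> of an active inequality
  shows that its multiplier, which is \<open>w i \<bullet> q\<close>, is nonnegative.
\<close>

theorem KKT_multipliers_exist:
  fixes g :: "nat \<Rightarrow> real ^ 'n \<Rightarrow> real" and v :: "nat \<Rightarrow> real ^ 'n"
  assumes fin: "finite (\<E> \<union> \<I>)" and disj: "\<E> \<inter> \<I> = {}"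
    and cont: "\<And>j. j \<in> \<E> \<union> \<I> \<Longrightarrow> continuous_on UNIV (g j)"
    and grad: "\<And>j. j \<in> \<E> \<union> \<I> \<Longrightarrow> GDERIV (g j) x :> v j"
    and x: "x \<in> feasible_set \<E> \<I> g"
    and min: "\<And>y. y \<in> feasible_set \<E> \<I> g \<Longrightarrow> (y - x) \<bullet> q \<ge> 0"
    and J: "J = {j \<in> \<E> \<union> \<I>. g j x = 0}"
    and inj: "inj_on v J" and indep: "independent (v ` J)"
  shows "\<exists>\<mu>. q = (\<Sum>j\<in>\<E> \<union> \<I>. \<mu> j *\<^sub>R v j) \<and> (\<forall>i\<in>\<I>. \<mu> i \<ge> 0 \<and> \<mu> i * g i x = 0)"
proof -
  obtain w where w: "\<And>i j. i \<in> J \<Longrightarrow> j \<in> J \<Longrightarrow> v i \<bullet> w j = (if i = j then 1 else 0)"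
    using dual_basis_exists[OF inj indep] by metis
  have dir: "d \<bullet> q \<ge> 0" if "\<And>j. j \<in> \<E> \<Longrightarrow> v j \<bullet> d = 0" "\<And>j. j \<in> J \<Longrightarrow> v j \<bullet> d \<ge> 0" for d
    by (rule feasible_direction_nonneg[OF fin cont grad x min J w that])
  have finJ: "finite J" using fin J by simp
  have EJ: "\<E> \<subseteq> J" using x J by (auto simp: feasible_set_def)
  obtain s z where sz: "s \<in> span (v ` J)" "\<And>u. u \<in> span (v ` J) \<Longrightarrow> orthogonal z u" "q = s + z"
    using orthogonal_subspace_decomp_exists[of "v ` J" q] by metis
  have vz: "v j \<bullet> z = 0" if "j \<in> J" for j
    using sz(2)[of "v j"] that by (simp add: span_base orthogonal_def inner_commute)
  have "(- z) \<bullet> q \<ge> 0" using EJ by (intro dir) (auto simp: vz)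
  moreover have "z \<bullet> q = z \<bullet> z" using sz by (simp add: inner_add_right orthogonal_def)
  ultimately have "z \<bullet> z \<le> 0" by simp
  then have "z = 0" by (metis antisym inner_ge_zero inner_eq_zero_iff)
  then have "q \<in> span (v ` J)" using sz by simp
  then obtain u where "q = (\<Sum>a\<in>v ` J. u a *\<^sub>R a)"
    using finJ by (auto simp: span_finite)
  then have q: "q = (\<Sum>j\<in>J. u (v j) *\<^sub>R v j)" by (simp add: sum.reindex[OF inj])
  define \<mu> where "\<mu> j = (if j \<in> J then u (v j) else 0)" for j
  have "q = (\<Sum>j\<in>\<E> \<union> \<I>. \<mu> j *\<^sub>R v j)"
    unfolding q \<mu>_def using fin J by (intro sum.mono_neutral_cong_left) auto
  moreover have "\<mu> i \<ge> 0" if "i \<in> \<I>" for i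
  proof (cases "i \<in> J")
    case True
    have "w i \<bullet> q \<ge> 0"
      using disj that EJ w True by (intro dir) (auto simp: subset_iff)
    moreover have "w i \<bullet> q = (\<Sum>j\<in>J. u (v j) * (v j \<bullet> w i))"
      by (simp add: q inner_sum_right inner_commute)
    moreover have "\<dots> = (\<Sum>j\<in>J. if j = i then u (v j) else 0)"
      using True by (intro sum.cong) (auto simp: w)
    ultimately show ?thesis using True finJ by (simp add: \<mu>_def)
  qed (simp add: \<mu>_def)
  moreover have "\<mu> i * g i x = 0" for i using J by (simp add: \<mu>_def)
  ultimately show ?thesis by blast
qed

section \<open>Constraints and gradients as linear functions of the coefficients\<close>

lemma gradient_monomial_poly:
  "real_polynomial_function (monomial \<alpha>)"
  "polynomial_function (gradient (monomial \<alpha>))"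
  "GDERIV (monomial \<alpha>) x :> gradient (monomial \<alpha>) x"
proof -
  show *: "real_polynomial_function (monomial \<alpha>)"
    unfolding monomial_def
  proof (rule real_polynomial_function_prod)
    show "real_polynomial_function (\<lambda>x::real ^ 'a. x $ i ^ \<alpha> i)" for i
      by (rule real_polynomial_function_power, rule real_polynomial_function.intros(1),
          rule bounded_linear_vec_nth)
  qed simp
  obtain G where G: "polynomial_function G" "\<And>x. GDERIV (monomial \<alpha>) x :> G x"
    using real_polynomial_function_gradient[OF *] by blast
  moreover have "G = gradient (monomial \<alpha>)" using gradient_eqI[OF G(2)] by (simp add: fun_eq_iff)
  ultimately show "polynomial_function (gradient (monomial \<alpha>))"
      "GDERIV (monomial \<alpha>) x :> gradient (monomial \<alpha>) x" by auto
qed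

lemma monomial_0: "monomial (\<lambda>_. 0) x = 1"
  by (simp add: monomial_def)

lemma gradient_monomial_0: "gradient (monomial (\<lambda>_. 0)) x = 0"
  by (rule gradient_eqI) (simp add: monomial_0[abs_def] GDERIV_const)

text \<open>
  The linear coefficients of a constraint are the constant terms of its gradient.
\<close>

lemma gradient_monomial_coordinate: "gradient (monomial (\<lambda>j. if j = i then 1 else 0)) x = axis i 1"
proof (rule gradient_eqI)
  have "((\<lambda>x. x $ i) has_derivative (\<lambda>h. h $ i)) (at x)" for x :: "real ^ 'a"
    by (rule bounded_linear_imp_has_derivative) (rule bounded_linear_vec_nth)
  then show "GDERIV (monomial (\<lambda>j. if j = i then 1 else 0)) x :> axis i 1"
    by (simp add: gderiv_def monomial_single[abs_def] inner_axis)
qed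

lemma gradient_poly_fun:
  "gradient (poly_fun d c) x = (\<Sum>\<alpha>\<in>exponents d. c \<alpha> *\<^sub>R gradient (monomial \<alpha>) x)"
proof (rule gradient_eqI)
  have "((\<lambda>x. \<Sum>\<alpha>\<in>exponents d. c \<alpha> * monomial \<alpha> x) has_derivative
      (\<lambda>h. \<Sum>\<alpha>\<in>exponents d. c \<alpha> * (h \<bullet> gradient (monomial \<alpha>) x))) (at x)"
    using gradient_monomial_poly(3)[of _ x] unfolding gderiv_def
    by (intro has_derivative_sum has_derivative_mult_right)
  then show "GDERIV (poly_fun d c) x :> (\<Sum>\<alpha>\<in>exponents d. c \<alpha> *\<^sub>R gradient (monomial \<alpha>) x)"
    by (simp add: gderiv_def poly_fun_monomial[abs_def] inner_sum_right)
qed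

text \<open>
  The constraints, their gradients and the map \<open>F\<close> each use one block of the coefficient vector. Writing
  them as sums over the whole index set exhibits them as linear functions of \<open>c\<close>, which is the form
  required of an affine family.
\<close>

lemma sum_coeff_index_block:
  fixes h :: "('n::finite \<Rightarrow> nat) \<Rightarrow> 'b::real_vector"
  shows "(\<Sum>\<iota>\<in>coeff_index a b m. c \<iota> *\<^sub>R (if fst \<iota> = t then h (snd \<iota>) else 0))
    = (\<Sum>\<alpha>\<in>{\<alpha>. (t, \<alpha>) \<in> coeff_index a b m}. c (t, \<alpha>) *\<^sub>R h \<alpha>)"
proof -
  have "(\<Sum>\<iota>\<in>coeff_index a b m. c \<iota> *\<^sub>R (if fst \<iota> = t then h (snd \<iota>) else 0))
      = (\<Sum>\<iota>\<in>{\<iota> \<in> coeff_index a b m. fst \<iota> = t}. c \<iota> *\<^sub>R h (snd \<iota>))"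
    by (rule sum.mono_neutral_cong_right) (auto simp: finite_coeff_index)
  also have "{\<iota> \<in> coeff_index a b m. fst \<iota> = t} = Pair t ` {\<alpha>. (t, \<alpha>) \<in> coeff_index a b m}"
    by force
  also have "(\<Sum>\<iota>\<in>\<dots>. c \<iota> *\<^sub>R h (snd \<iota>)) = (\<Sum>\<alpha>\<in>{\<alpha>. (t, \<alpha>) \<in> coeff_index a b m}. c (t, \<alpha>) *\<^sub>R h \<alpha>)"
    by (simp add: sum.reindex inj_on_def)
  finally show ?thesis .
qed

lemma coeff_index_Inl: "{\<alpha>. (Inl i, \<alpha>) \<in> coeff_index a b m} = exponents (a i)"
  and coeff_index_Inr: "j \<in> {1..m} \<Longrightarrow> {\<alpha>. (Inr j, \<alpha>) \<in> coeff_index a b m} = exponents (b j)"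
  by (auto simp: coeff_index_def)

lemma poly_constraint_sum:
  assumes "j \<in> {1..m}"
  shows "poly_constraint b c j x =
    (\<Sum>\<iota>\<in>coeff_index a b m. c \<iota> * (if fst \<iota> = Inr j then monomial (snd \<iota>) x else 0))"
  using sum_coeff_index_block[where c = c and t = "Inr j" and h = "\<lambda>\<alpha>. monomial \<alpha> x" and a = a and b = b]
  by (simp only: coeff_index_Inr[OF assms] poly_constraint_def poly_fun_monomial real_scaleR_def)

lemma gradient_poly_constraint_sum:
  assumes "j \<in> {1..m}"
  shows "gradient (poly_constraint b c j) x = (\<Sum>\<iota>\<in>coeff_index a b m.
    c \<iota> *\<^sub>R (if fst \<iota> = Inr j then gradient (monomial (snd \<iota>)) x else 0))"
  using sum_coeff_index_block[where c = c and t = "Inr j" and h = "\<lambda>\<alpha>. gradient (monomial \<alpha>) x"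
      and a = a and b = b]
  by (simp only: coeff_index_Inr[OF assms] poly_constraint_def[abs_def] gradient_poly_fun)

lemma poly_map_sum:
  "poly_map a c x = (\<Sum>\<iota>\<in>coeff_index a b m.
    c \<iota> *\<^sub>R (\<chi> i. if fst \<iota> = Inl i then monomial (snd \<iota>) x else 0))"
proof -
  have "poly_map a c x $ i = (\<Sum>\<iota>\<in>coeff_index a b m.
      c \<iota> * (if fst \<iota> = Inl i then monomial (snd \<iota>) x else 0))" for i
    using sum_coeff_index_block[where c = c and t = "Inl i" and h = "\<lambda>\<alpha>. monomial \<alpha> x" and a = a and b = b]
    by (simp only: coeff_index_Inl poly_map_def poly_fun_monomial real_scaleR_def vec_lambda_beta)
  then show ?thesis by (simp only: vec_eq_iff sum_component vector_scaleR_component vec_lambda_beta real_scaleR_def) simp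
qed


section \<open>Finiteness and linear independence for generic coefficients\<close>

text \<open>
  The number of constraints under consideration varies, but the unknowns have to live in a fixed type. At
  most \<open>n\<close> linearly independent gradients exist, so \<open>n\<close> slots are enough: slot \<open>k\<close> holds the constraint
  \<open>\<tau> k\<close> if this is a valid index, and is empty otherwise.
\<close>

definition slots :: "nat \<Rightarrow> ('n \<Rightarrow> nat) \<Rightarrow> 'n set" where
  "slots m \<tau> = {k. \<tau> k \<in> {1..m}}"

definition in_gradient_span ::
  "(nat \<Rightarrow> nat) \<Rightarrow> nat \<Rightarrow> (('n::finite + nat) \<times> ('n \<Rightarrow> nat) \<Rightarrow> real) \<Rightarrow> ('n \<Rightarrow> nat)
    \<Rightarrow> real ^ 'n \<Rightarrow> real ^ 'n \<Rightarrow> real ^ 'n \<Rightarrow> bool" where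
  "in_gradient_span b m c \<tau> x u y \<longleftrightarrow>
    y = (\<Sum>k\<in>slots m \<tau>. (u $ k) *\<^sub>R gradient (poly_constraint b c (\<tau> k)) x) \<and>
    (\<forall>k\<in>slots m \<tau>. poly_constraint b c (\<tau> k) x = 0)"

lemma polynomial_function_vec_lambda:
  fixes f :: "'i::finite \<Rightarrow> 'a::euclidean_space \<Rightarrow> real"
  assumes "\<And>i. real_polynomial_function (f i)"
  shows "polynomial_function (\<lambda>z. \<chi> i. f i z)"
  unfolding polynomial_function_iff_Basis_inner
  using assms by (auto simp: Basis_vec_def inner_axis)

lemma polynomial_function_Pair:
  fixes f :: "'a::euclidean_space \<Rightarrow> 'b::euclidean_space" and g :: "'a \<Rightarrow> 'c::euclidean_space"
  assumes "polynomial_function f" "polynomial_function g"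
  shows "polynomial_function (\<lambda>z. (f z, g z))"
  using assms unfolding polynomial_function_iff_Basis_inner by (auto simp: Basis_prod_def)

lemma polynomial_function_fst_comp:
  fixes f :: "'a::euclidean_space \<Rightarrow> 'c::euclidean_space"
  assumes "polynomial_function f"
  shows "polynomial_function (\<lambda>z::'a \<times> 'b::euclidean_space. f (fst z))"
  using polynomial_function_compose[OF polynomial_function_bounded_linear[OF bounded_linear_fst] assms]
  by (simp add: o_def)

lemma real_polynomial_function_snd_nth:
  "real_polynomial_function (\<lambda>z::'a::euclidean_space \<times> (real ^ 'n). snd z $ k)"
  by (rule real_polynomial_function.intros(1))
    (rule bounded_linear_compose[OF bounded_linear_vec_nth bounded_linear_snd])

text \<open>
  The unknowns are \<open>z = (x, u)\<close>, and the equations are \<open>G x - \<Sum>u_k \<nabla>g_{\<tau> k} x = 0\<close> and, for each slot,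
  \<open>g_{\<tau> k} x = 0\<close>, where \<open>G = \<Sum>c \<iota> \<gamma> \<iota>\<close>. The coefficient at \<open>\<pi> l\<close> is the constant term of \<open>G_l\<close>, and the one
  at \<open>(Inr (\<tau> k), 0)\<close> is the constant term of \<open>g_{\<tau> k}\<close>. These translate the system in all
  equations of nonempty slots. An empty slot \<open>k\<close> gets the equation \<open>u_k + const = 0\<close>, which keeps
  the system square and does not restrict \<open>x\<close>.
\<close>

proposition AE_finite_gradient_span:
  fixes a :: "'n::finite \<Rightarrow> nat" and b :: "nat \<Rightarrow> nat" and m :: nat and \<tau> :: "'n \<Rightarrow> nat"
    and \<gamma> :: "('n + nat) \<times> ('n \<Rightarrow> nat) \<Rightarrow> real ^ 'n \<Rightarrow> real ^ 'n"
    and \<pi> :: "'n \<Rightarrow> ('n + nat) \<times> ('n \<Rightarrow> nat)"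
  assumes inj: "inj_on \<tau> (slots m \<tau>)"
    and poly: "\<And>\<iota>. polynomial_function (\<gamma> \<iota>)"
    and \<pi>: "\<And>l. \<pi> l \<in> coeff_index a b m" "\<And>l x. \<gamma> (\<pi> l) x = axis l 1"
      "\<And>l k. k \<in> slots m \<tau> \<Longrightarrow> fst (\<pi> l) \<noteq> Inr (\<tau> k)"
    and \<gamma>0: "\<And>k x. k \<in> slots m \<tau> \<Longrightarrow> \<gamma> (Inr (\<tau> k), \<lambda>_. 0) x = 0"
  shows "AE c in coeff_measure a b m.
    finite {x. \<exists>u. in_gradient_span b m c \<tau> x u (\<Sum>\<iota>\<in>coeff_index a b m. c \<iota> *\<^sub>R \<gamma> \<iota> x)}"
proof -
  let ?I = "coeff_index a b m" and ?S = "slots m \<tau>"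
  define \<sigma> where "\<sigma> k = (Inr (\<tau> k) :: 'n + nat, (\<lambda>_. 0) :: 'n \<Rightarrow> nat)" for k
  have \<sigma>I: "\<sigma> k \<in> ?I" if "k \<in> ?S" for k
    using that by (auto simp: \<sigma>_def coeff_index_def slots_def exponents_def)
  define \<phi> :: "('n + nat) \<times> ('n \<Rightarrow> nat) \<Rightarrow> (real ^ 'n) \<times> (real ^ 'n) \<Rightarrow> (real ^ 'n) \<times> (real ^ 'n)"
    where "\<phi> \<iota> z = (\<gamma> \<iota> (fst z) - (\<Sum>k\<in>?S. (snd z $ k) *\<^sub>R
          (if fst \<iota> = Inr (\<tau> k) then gradient (monomial (snd \<iota>)) (fst z) else 0)),
        \<chi> k. if k \<in> ?S \<and> fst \<iota> = Inr (\<tau> k) then monomial (snd \<iota>) (fst z) else 0)" for \<iota> z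
  define D :: "(real ^ 'n) \<times> (real ^ 'n) \<Rightarrow> (real ^ 'n) \<times> (real ^ 'n)"
    where "D w = (0, \<chi> k. if k \<in> ?S then 0 else snd w $ k)" for w
  define L :: "(real ^ 'n) \<times> (real ^ 'n) \<Rightarrow> ('n + nat) \<times> ('n \<Rightarrow> nat) \<Rightarrow> real"
    where "L w \<iota> = (\<Sum>l\<in>UNIV. if \<iota> = \<pi> l then fst w $ l else 0)
        + (\<Sum>k\<in>?S. if \<iota> = \<sigma> k then snd w $ k else 0)" for w \<iota>
  have polyD: "polynomial_function D"
  proof -
    have "real_polynomial_function (\<lambda>w::(real ^ 'n) \<times> (real ^ 'n). if k \<in> ?S then 0 else snd w $ k)" for k
      using real_polynomial_function_snd_nth real_polynomial_function.intros(2)[of 0]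
      by (cases "k \<in> ?S") simp_all
    then show ?thesis
      unfolding D_def
      by (intro polynomial_function_Pair polynomial_function_vec_lambda polynomial_function_const)
  qed
  have poly\<phi>: "polynomial_function (\<phi> \<iota>)" for \<iota>
  proof -
    have "polynomial_function (\<lambda>x::real ^ 'n.
        if fst \<iota> = Inr (\<tau> k) then gradient (monomial (snd \<iota>)) x else 0)" for k
      using gradient_monomial_poly(2)
      by (cases "fst \<iota> = Inr (\<tau> k)") simp_all
    moreover have "polynomial_function (\<lambda>z::(real ^ 'n) \<times> (real ^ 'n). snd z $ k)" for k
      using real_polynomial_function_snd_nth by (simp add: real_polynomial_function_eq)
    moreover have "real_polynomial_function (\<lambda>z::(real ^ 'n) \<times> (real ^ 'n). 
        if k \<in> ?S \<and> fst \<iota> = Inr (\<tau> k) then monomial (snd \<iota>) (fst z) else 0)" for k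
    proof (cases "k \<in> ?S \<and> fst \<iota> = Inr (\<tau> k)")
      case True
      have "polynomial_function (\<lambda>z::(real ^ 'n) \<times> (real ^ 'n). monomial (snd \<iota>) (fst z))"
        by (rule polynomial_function_fst_comp)
          (rule gradient_monomial_poly(1)[unfolded real_polynomial_function_eq])
      with True show ?thesis by (simp add: real_polynomial_function_eq)
    next
      case False
      show ?thesis unfolding if_not_P[OF False] by (rule real_polynomial_function.intros(2))
    qed
    ultimately show ?thesis
      unfolding \<phi>_def
      by (intro polynomial_function_Pair polynomial_function_diff polynomial_function_sum
          polynomial_function_mult polynomial_function_vec_lambda polynomial_function_fst_comp poly) auto
  qed
  have \<phi>\<pi>: "\<phi> (\<pi> l) z = (axis l 1, 0)" for l z
    using \<pi>(2,3) by (auto simp: \<phi>_def vec_eq_iff intro!: sum.neutral)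
  have \<phi>\<sigma>: "\<phi> (\<sigma> k) z = (0, axis k 1)" if "k \<in> ?S" for k z
  proof -
    have slot: "k' \<in> ?S \<and> \<tau> k = \<tau> k' \<longleftrightarrow> k' = k" for k'
      using inj that by (auto simp: inj_on_def)
    show ?thesis
    proof (rule prod_eqI)
      show "fst (\<phi> (\<sigma> k) z) = fst (0, axis k 1)"
        using \<gamma>0[OF that] by (simp add: \<phi>_def \<sigma>_def gradient_monomial_0 cong: if_cong)
      show "snd (\<phi> (\<sigma> k) z) = snd (0, axis k 1)"
        by (simp add: \<phi>_def \<sigma>_def monomial_0 vec_eq_iff axis_def slot)
    qed
  qed
  have "\<exists>w. AE c in PiM ?I (\<lambda>_. lborel). finite {z. D z + (\<Sum>\<iota>\<in>?I. c \<iota> *\<^sub>R \<phi> \<iota> z) + D w = 0}"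
  \<comment> \<open>The type \<open>'n bit0\<close> has twice as many elements as \<open>'n\<close>, one for each coordinate of \<open>(x, u)\<close>.\<close>
  proof (rule AE_affine_family_finite_zeros_euclidean[where 'm = "'n bit0" and L = L])
    show "DIM((real ^ 'n) \<times> (real ^ 'n)) = CARD('n bit0)" by simp
    show "(\<lambda>w. L w \<iota>) \<in> borel_measurable borel" for \<iota>
    proof -
      have "(\<lambda>w::(real ^ 'n) \<times> (real ^ 'n). if P then fst w $ l else 0) \<in> borel_measurable borel"
           "(\<lambda>w::(real ^ 'n) \<times> (real ^ 'n). if P then snd w $ l else 0) \<in> borel_measurable borel" for P l
        by (cases P; auto intro!: borel_measurable_continuous_onI continuous_intros)+
      then show ?thesis unfolding L_def by (intro borel_measurable_add borel_measurable_sum)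
    qed
    show "D \<in> borel_measurable borel"
      by (intro borel_measurable_continuous_onI continuous_on_polymonial_function polyD)
    show "(\<Sum>\<iota>\<in>?I. L w \<iota> *\<^sub>R \<phi> \<iota> z) + D w = w" for w z
    proof -
      have delta: "(\<Sum>\<iota>\<in>?I. (if \<iota> = \<kappa> then r else 0) *\<^sub>R \<phi> \<iota> z) = r *\<^sub>R \<phi> \<kappa> z" if "\<kappa> \<in> ?I" for \<kappa> r
      proof -
        have "(\<Sum>\<iota>\<in>?I. (if \<iota> = \<kappa> then r else 0) *\<^sub>R \<phi> \<iota> z) = (\<Sum>\<iota>\<in>?I. if \<iota> = \<kappa> then r *\<^sub>R \<phi> \<iota> z else 0)"
          by (intro sum.cong) auto
        also have "\<dots> = r *\<^sub>R \<phi> \<kappa> z"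
          using that by (subst sum.delta[OF finite_coeff_index]) simp
        finally show ?thesis .
      qed
      have "(\<Sum>\<iota>\<in>?I. L w \<iota> *\<^sub>R \<phi> \<iota> z) =
          (\<Sum>\<iota>\<in>?I. \<Sum>l\<in>UNIV. (if \<iota> = \<pi> l then fst w $ l else 0) *\<^sub>R \<phi> \<iota> z) +
          (\<Sum>\<iota>\<in>?I. \<Sum>k\<in>?S. (if \<iota> = \<sigma> k then snd w $ k else 0) *\<^sub>R \<phi> \<iota> z)"
        by (simp add: L_def scaleR_add_left scaleR_sum_left sum.distrib)
      also have "\<dots> = (\<Sum>l\<in>UNIV. (fst w $ l) *\<^sub>R \<phi> (\<pi> l) z) + (\<Sum>k\<in>?S. (snd w $ k) *\<^sub>R \<phi> (\<sigma> k) z)"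
        by (subst (1 2) sum.swap) (simp add: delta \<pi>(1) \<sigma>I)
      also have "\<dots> = (\<Sum>l\<in>UNIV. (fst w $ l) *\<^sub>R (axis l 1, 0)) + (\<Sum>k\<in>?S. (snd w $ k) *\<^sub>R (0, axis k 1))"
        by (simp add: \<phi>\<pi> \<phi>\<sigma>)
      also have "\<dots> + D w = w"
      proof (rule prod_eqI)
        have "(\<Sum>l\<in>UNIV. (fst w $ l) *\<^sub>R axis l 1) = fst w"
          using basis_expansion[of "fst w"] by (simp add: scalar_mult_eq_scaleR)
        then show "fst ((\<Sum>l\<in>UNIV. (fst w $ l) *\<^sub>R (axis l 1, 0)) +
            (\<Sum>k\<in>?S. (snd w $ k) *\<^sub>R (0, axis k 1)) + D w) = fst w"
          by (simp add: fst_sum D_def)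
        have "(\<Sum>k\<in>?S. snd w $ k * axis k 1 $ j) = (\<Sum>k\<in>?S. if k = j then snd w $ k else 0)" for j
          by (intro sum.cong) (auto simp: axis_def)
        then show "snd ((\<Sum>l\<in>UNIV. (fst w $ l) *\<^sub>R (axis l 1, 0)) +
            (\<Sum>k\<in>?S. (snd w $ k) *\<^sub>R (0, axis k 1)) + D w) = snd w"
          by (simp add: snd_sum D_def vec_eq_iff)
      qed
      finally show ?thesis .
    qed
  qed (auto intro: poly\<phi> polyD finite_coeff_index)
  then obtain w where "AE c in PiM ?I (\<lambda>_. lborel). finite {z. D z + (\<Sum>\<iota>\<in>?I. c \<iota> *\<^sub>R \<phi> \<iota> z) + D w = 0}"
    by auto
  then show ?thesis
    unfolding coeff_measure_def
  proof eventually_elim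
    case (elim c)
    have "{x. \<exists>u. in_gradient_span b m c \<tau> x u (\<Sum>\<iota>\<in>?I. c \<iota> *\<^sub>R \<gamma> \<iota> x)}
      \<subseteq> fst ` {z. D z + (\<Sum>\<iota>\<in>?I. c \<iota> *\<^sub>R \<phi> \<iota> z) + D w = 0}"
    proof
      fix x assume "x \<in> {x. \<exists>u. in_gradient_span b m c \<tau> x u (\<Sum>\<iota>\<in>?I. c \<iota> *\<^sub>R \<gamma> \<iota> x)}"
      then obtain u where u: "(\<Sum>\<iota>\<in>?I. c \<iota> *\<^sub>R \<gamma> \<iota> x) =
            (\<Sum>k\<in>?S. (u $ k) *\<^sub>R gradient (poly_constraint b c (\<tau> k)) x)"
          "\<And>k. k \<in> ?S \<Longrightarrow> poly_constraint b c (\<tau> k) x = 0"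
        by (auto simp: in_gradient_span_def)
      \<comment> \<open>Empty slots take the value that satisfies their equation \<open>u_k + const = 0\<close>.\<close>
      define z where "z = (x, \<chi> k. if k \<in> ?S then u $ k else - (snd w $ k))"
      have \<tau>: "\<tau> k \<in> {1..m}" if "k \<in> ?S" for k using that by (simp add: slots_def)
      have "D z + (\<Sum>\<iota>\<in>?I. c \<iota> *\<^sub>R \<phi> \<iota> z) + D w = 0"
      proof (rule prod_eqI)
        have "(\<Sum>\<iota>\<in>?I. c \<iota> *\<^sub>R (\<Sum>k\<in>?S. (u $ k) *\<^sub>R
              (if fst \<iota> = Inr (\<tau> k) then gradient (monomial (snd \<iota>)) x else 0)))
            = (\<Sum>k\<in>?S. (u $ k) *\<^sub>R (\<Sum>\<iota>\<in>?I. c \<iota> *\<^sub>R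
              (if fst \<iota> = Inr (\<tau> k) then gradient (monomial (snd \<iota>)) x else 0)))"
          unfolding scaleR_sum_right by (subst sum.swap) (simp add: mult.commute)
        also have "\<dots> = (\<Sum>k\<in>?S. (u $ k) *\<^sub>R gradient (poly_constraint b c (\<tau> k)) x)"
          by (intro sum.cong refl) (simp only: gradient_poly_constraint_sum[OF \<tau>, where a = a])
        finally show "fst (D z + (\<Sum>\<iota>\<in>?I. c \<iota> *\<^sub>R \<phi> \<iota> z) + D w) = fst 0"
          by (simp add: fst_sum D_def \<phi>_def z_def scaleR_diff_right sum_subtractf u(1) cong: if_cong)
        have "(\<Sum>\<iota>\<in>?I. c \<iota> * (if k \<in> ?S \<and> fst \<iota> = Inr (\<tau> k) then monomial (snd \<iota>) x else 0)) = 0" for k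
          using u(2)[of k] poly_constraint_sum[OF \<tau>, of k b c x a] by (cases "k \<in> ?S") auto
        then show "snd (D z + (\<Sum>\<iota>\<in>?I. c \<iota> *\<^sub>R \<phi> \<iota> z) + D w) = snd 0"
          by (simp add: snd_sum D_def \<phi>_def z_def vec_eq_iff del: split_paired_All cong: if_cong)
      qed
      then show "x \<in> fst ` {z. D z + (\<Sum>\<iota>\<in>?I. c \<iota> *\<^sub>R \<phi> \<iota> z) + D w = 0}"
        by (intro image_eqI[of _ _ z]) (auto simp: z_def)
    qed
    then show ?case using elim finite_surj by blast
  qed
qed

text \<open>
  An independent family has at most \<open>n\<close> members, so its indices can be put into distinct slots.
\<close>

lemma slots_for_span:
  fixes v :: "nat \<Rightarrow> real ^ 'n::finite"
  assumes J: "J \<subseteq> {1..m}" and inj: "inj_on v J" and indep: "independent (v ` J)"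
    and y: "y \<in> span (v ` J)"
  shows "\<exists>\<tau>::'n \<Rightarrow> nat. \<exists>u::real ^ 'n. range \<tau> \<subseteq> {..m} \<and> inj_on \<tau> (slots m \<tau>) \<and> \<tau> ` slots m \<tau> = J \<and>
    y = (\<Sum>k\<in>slots m \<tau>. (u $ k) *\<^sub>R v (\<tau> k))"
proof -
  have finJ: "finite J" using J finite_subset by blast
  have "card J = card (v ` J)" by (simp add: card_image[OF inj])
  also have "\<dots> \<le> CARD('n)" using independent_bound[OF indep] by simp
  finally obtain K :: "'n set" where K: "card K = card J"
    by (metis obtain_subset_with_card_n)
  then obtain h where h: "bij_betw h K J" using finJ finite_same_card_bij[of K J] by auto
  define \<tau> where "\<tau> k = (if k \<in> K then h k else 0)" for k
  have hJ: "h k \<in> J" if "k \<in> K" for k using h that by (auto simp: bij_betw_def)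
  then have "h k \<in> {1..m}" if "k \<in> K" for k using that J by blast
  then have slots: "slots m \<tau> = K"
    by (auto simp: slots_def \<tau>_def)
  have \<tau>h: "bij_betw \<tau> K J" using h by (simp add: \<tau>_def bij_betw_def inj_on_def)
  obtain r where r: "y = (\<Sum>a\<in>v ` J. r a *\<^sub>R a)"
    using y finJ by (auto simp: span_finite)
  have "y = (\<Sum>j\<in>J. r (v j) *\<^sub>R v j)" by (simp add: r sum.reindex[OF inj])
  also have "\<dots> = (\<Sum>k\<in>K. r (v (\<tau> k)) *\<^sub>R v (\<tau> k))"
    by (rule sum.reindex_bij_betw[OF \<tau>h, symmetric])
  finally have "y = (\<Sum>k\<in>K. ((\<chi> k. r (v (\<tau> k))) $ k) *\<^sub>R v (\<tau> k))" by simp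
  moreover have "range \<tau> \<subseteq> {..m}" using hJ J by (fastforce simp: \<tau>_def)
  ultimately show ?thesis
    using \<tau>h slots unfolding bij_betw_def by metis
qed

lemma measurable_coeff: "\<iota> \<in> coeff_index a b m \<Longrightarrow> (\<lambda>c. c \<iota>) \<in> borel_measurable (coeff_measure a b m)"
  unfolding coeff_measure_def
  using measurable_component_singleton[of \<iota> "coeff_index a b m" "\<lambda>_. lborel :: real measure"] by simp

lemma measurable_poly_constraint:
  assumes "j \<in> {1..m}"
  shows "(\<lambda>c. poly_constraint b c j x) \<in> borel_measurable (coeff_measure a b m)"
    and "(\<lambda>c. gradient (poly_constraint b c j) x) \<in> borel_measurable (coeff_measure a b m)"
  unfolding poly_constraint_sum[OF assms, where a = a] gradient_poly_constraint_sum[OF assms, where a = a]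
  by (intro borel_measurable_sum borel_measurable_times borel_measurable_scaleR borel_measurable_const
      measurable_coeff; assumption)+

lemma continuous_poly_constraint:
  "continuous_on UNIV (poly_constraint b c j)"
  "continuous_on UNIV (gradient (poly_constraint b c j))"
proof -
  have "polynomial_function (poly_constraint b c j)"
    unfolding poly_constraint_def[abs_def] poly_fun_monomial real_polynomial_function_eq[symmetric]
    using gradient_monomial_poly(1) finite_exponents
    by (intro real_polynomial_function_sum real_polynomial_function.intros(4) real_polynomial_function.intros(2)) auto
  moreover have "polynomial_function (gradient (poly_constraint b c j))"
    unfolding poly_constraint_def[abs_def] gradient_poly_fun[abs_def]
    using gradient_monomial_poly(2) finite_exponents
    by (intro polynomial_function_sum polynomial_function_cmul) auto
  ultimately show "continuous_on UNIV (poly_constraint b c j)"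
    "continuous_on UNIV (gradient (poly_constraint b c j))"
    by (simp_all add: continuous_on_polymonial_function)
qed

lemma GDERIV_poly_constraint: "GDERIV (poly_constraint b c j) x :> gradient (poly_constraint b c j) x"
  unfolding poly_constraint_def[abs_def] by (rule GDERIV_poly_fun)

lemma poly_constraint_shift_constant:
  fixes c :: "('n::finite + nat) \<times> ('n \<Rightarrow> nat) \<Rightarrow> real"
    and a :: "'n \<Rightarrow> nat" and b :: "nat \<Rightarrow> nat" and i :: nat and s :: real
  assumes j: "j \<in> {1..m}"
  defines "c' \<equiv> \<lambda>\<iota>\<in>coeff_index a b m. c \<iota> + (if \<iota> = (Inr i, \<lambda>_. 0) then s else 0)"
  shows "poly_constraint b c' j x = poly_constraint b c j x + (if j = i then s else 0)"
    and "gradient (poly_constraint b c' j) x = gradient (poly_constraint b c j) x"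
proof -
  have eq: "poly_constraint b c' j x = poly_constraint b c j x + (if j = i then s else 0)" for x
  proof -
    have "poly_constraint b c' j x =
        (\<Sum>\<alpha>\<in>exponents (b j). (c (Inr j, \<alpha>) + (if j = i \<and> \<alpha> = (\<lambda>_. 0) then s else 0)) * monomial \<alpha> x)"
      unfolding poly_constraint_def poly_fun_monomial c'_def
      using j by (intro sum.cong refl) (auto simp: coeff_index_def)
    also have "\<dots> = poly_constraint b c j x +
        (\<Sum>\<alpha>\<in>exponents (b j). if \<alpha> = (\<lambda>_::'n. 0) then (if j = i then s else 0) else 0)"
      unfolding poly_constraint_def poly_fun_monomial
      by (subst sum.distrib[symmetric], intro sum.cong refl) (auto simp: algebra_simps monomial_0)
    also have "(\<lambda>_::'n. 0) \<in> exponents (b j)" by (simp add: exponents_def)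
    then have "(\<Sum>\<alpha>\<in>exponents (b j). if \<alpha> = (\<lambda>_::'n. 0) then (if j = i then s else 0) else 0)
        = (if j = i then s else 0)"
      by (subst sum.delta[OF finite_exponents]) simp
    finally show ?thesis .
  qed
  show "poly_constraint b c' j x = poly_constraint b c j x + (if j = i then s else 0)" by (rule eq)
  have "GDERIV (\<lambda>x. poly_constraint b c j x + (if j = i then s else 0)) x :> gradient (poly_constraint b c j) x + 0"
    by (intro GDERIV_add GDERIV_poly_constraint GDERIV_const)
  then show "gradient (poly_constraint b c' j) x = gradient (poly_constraint b c j) x"
    by (intro gradient_eqI) (simp add: eq[abs_def])
qed

text \<open>
  The points where \<open>\<nabla>g_i\<close> is a combination of the other gradients on the common zero set of their
  constraints are finitely many, and they do not move when the constant term of \<open>g_i\<close> varies. Probing with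
  this term alone makes \<open>g_i\<close> nonzero at all of them.
\<close>

proposition AE_not_gradient_span_of_others:
  fixes a :: "'n::finite \<Rightarrow> nat" and b :: "nat \<Rightarrow> nat" and m :: nat and \<tau> :: "'n \<Rightarrow> nat"
  assumes i: "i \<in> {1..m}" "b i > 0" "i \<notin> \<tau> ` slots m \<tau>" and inj: "inj_on \<tau> (slots m \<tau>)"
  shows "AE c in coeff_measure a b m. \<not> (\<exists>x u.
    in_gradient_span b m c \<tau> x u (gradient (poly_constraint b c i) x) \<and> poly_constraint b c i x = 0)"
proof -
  let ?I = "coeff_index a b m" and ?M = "coeff_measure a b m" and ?S = "slots m \<tau>"
  define bad where "bad c \<longleftrightarrow> (\<exists>x u. in_gradient_span b m c \<tau> x u (gradient (poly_constraint b c i) x)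
    \<and> poly_constraint b c i x = 0)" for c
  have \<tau>: "\<tau> k \<in> {1..m}" if "k \<in> ?S" for k using that by (simp add: slots_def)
  define h where "h c z = norm (gradient (poly_constraint b c i) (fst z) -
        (\<Sum>k\<in>?S. (snd z $ k) *\<^sub>R gradient (poly_constraint b c (\<tau> k)) (fst z))) +
      (\<Sum>k\<in>?S. \<bar>poly_constraint b c (\<tau> k) (fst z)\<bar>) + \<bar>poly_constraint b c i (fst z)\<bar>"
    for c and z :: "(real ^ 'n) \<times> (real ^ 'n)"
  have bad_iff: "bad c \<longleftrightarrow> (\<exists>z. h c z = 0)" for c
    unfolding bad_def h_def in_gradient_span_def
    by (auto simp: add_nonneg_eq_0_iff sum_nonneg sum_nonneg_eq_0_iff)
  have bad_sets: "{c \<in> space ?M. bad c} \<in> sets ?M"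
    unfolding bad_iff
  proof (rule sets_ex_zero)
    show "continuous_on UNIV (h c)" for c
      unfolding h_def
      by (intro continuous_intros continuous_on_compose2[OF continuous_poly_constraint(1)]
          continuous_on_compose2[OF continuous_poly_constraint(2)]) auto
    show "(\<lambda>c. h c z) \<in> borel_measurable ?M" for z
      unfolding h_def
      by (intro borel_measurable_add borel_measurable_norm measurable_compose[OF _ borel_measurable_norm]
          borel_measurable_diff borel_measurable_sum borel_measurable_scaleR borel_measurable_const
          borel_measurable_abs measurable_poly_constraint \<tau> i)
  qed
  have fin: "AE c in ?M. finite {x. \<exists>u. in_gradient_span b m c \<tau> x u (gradient (poly_constraint b c i) x)}"
    unfolding gradient_poly_constraint_sum[OF i(1), where a = a]
  proof (rule AE_finite_gradient_span[OF inj, where \<pi> = "\<lambda>l. (Inr i, \<lambda>j. if j = l then 1 else 0)"])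
    show "polynomial_function (\<lambda>x. if fst \<iota> = Inr i then gradient (monomial (snd \<iota>)) x else 0)"
      for \<iota> :: "('n + nat) \<times> ('n \<Rightarrow> nat)"
      using gradient_monomial_poly(2) by (cases "fst \<iota> = Inr i") simp_all
    show "(Inr i, \<lambda>j. if j = l then 1 else 0) \<in> ?I" for l
      using i by (auto simp: coeff_index_def exponents_def)
  qed (use i in \<open>auto simp: gradient_monomial_coordinate[simplified] gradient_monomial_0\<close>)
  have "AE c in ?M. AE s in lborel. \<not> bad (\<lambda>\<iota>\<in>?I. c \<iota> + (if \<iota> = (Inr i, \<lambda>_. 0) then s else 0))"
    using fin
  proof eventually_elim
    case (elim c)
    let ?X = "{x. \<exists>u. in_gradient_span b m c \<tau> x u (gradient (poly_constraint b c i) x)}"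
    have "AE s in lborel. s \<notin> (\<lambda>x. - poly_constraint b c i x) ` ?X"
      using elim by (intro AE_not_in countable_imp_null_set_lborel countable_finite finite_imageI)
    then show ?case
    proof eventually_elim
      case (elim s)
      let ?c = "\<lambda>\<iota>\<in>?I. c \<iota> + (if \<iota> = (Inr i, \<lambda>_. 0) then s else 0)"
      have "\<tau> k \<noteq> i" if "k \<in> ?S" for k using i(3) that by auto
      then have "in_gradient_span b m ?c \<tau> x u (gradient (poly_constraint b ?c i) x) \<longleftrightarrow>
          in_gradient_span b m c \<tau> x u (gradient (poly_constraint b c i) x)" for x u
        using \<tau> i(1) unfolding in_gradient_span_def by (simp add: poly_constraint_shift_constant)
      then show ?case
        using elim i(1) unfolding bad_def
        by (auto simp: poly_constraint_shift_constant eq_neg_iff_add_eq_0 add.commute)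
    qed
  qed
  then have ae: "AE c in PiM ?I (\<lambda>_. lborel). AE s in lborel.
      \<not> bad (\<lambda>\<iota>\<in>?I. c \<iota> + (if \<iota> = (Inr i, \<lambda>_. 0) then s else 0))"
    by (simp only: coeff_measure_def)
  have L: "(\<lambda>s. if \<iota> = (Inr i, \<lambda>_. 0) then s else 0) \<in> borel_measurable (borel :: real measure)"
    for \<iota> :: "('n + nat) \<times> ('n \<Rightarrow> nat)" by (cases "\<iota> = (Inr i, \<lambda>_. 0)") simp_all
  let ?P = "PiM ?I (\<lambda>_. lborel :: real measure) \<Otimes>\<^sub>M (lborel :: real measure)"
  have "{c \<in> space ?M. \<not> bad c} \<in> sets ?M" by (rule sets.sets_Collect_neg[OF bad_sets])
  from measurable_sets[OF measurable_fst[of ?M "lborel :: real measure"] this]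
  have Q: "{p \<in> space ?P. \<not> bad (fst p)} \<in> sets ?P"
    by (simp add: coeff_measure_def vimage_def Int_def space_pair_measure mem_Times_iff conj_ac)
  have "AE s in (lborel :: real measure). AE c in PiM ?I (\<lambda>_. lborel). \<not> bad c"
    by (rule AE_PiM_lborel_probe[OF finite_coeff_index L Q ae])
  then show ?thesis
    using eventually_happens'[of "ae_filter (lborel :: real measure)"]
    unfolding bad_def coeff_measure_def by (auto simp: ae_filter_eq_bot_iff)
qed

text \<open>
  A maximal independent subfamily of the active gradients fits into the slots. An active constraint outside
  it would have a gradient in its span, which \<open>good\<close> excludes.
\<close>

lemma active_gradients_independent:
  fixes c :: "('n::finite + nat) \<times> ('n \<Rightarrow> nat) \<Rightarrow> real"
  assumes good: "\<And>i \<tau>. i \<in> {1..m} \<Longrightarrow> i \<notin> \<tau> ` slots m \<tau> \<Longrightarrow> inj_on \<tau> (slots m \<tau>) \<Longrightarrow>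
      \<not> (\<exists>x u. in_gradient_span b m c \<tau> x u (gradient (poly_constraint b c i) x) \<and> poly_constraint b c i x = 0)"
  defines "J \<equiv> \<lambda>x. {j \<in> {1..m}. poly_constraint b c j x = 0}"
    and "v \<equiv> \<lambda>x j. gradient (poly_constraint b c j) x"
  shows "inj_on (v x) (J x) \<and> independent (v x ` J x)"
proof -
  obtain B where B: "B \<subseteq> v x ` J x" "independent B" "v x ` J x \<subseteq> span B"
    using maximal_independent_subset[of "v x ` J x"] by blast
  then obtain J' where J': "J' \<subseteq> J x" "inj_on (v x) J'" "B = v x ` J'"
    by (metis subset_image_inj)
  have "J' = J x"
  proof (rule ccontr)
    assume "J' \<noteq> J x"
    then obtain i where i: "i \<in> J x" "i \<notin> J'" using J'(1) by blast
    have "J' \<subseteq> {1..m}" "v x i \<in> span (v x ` J')" using J' B(3) i by (auto simp: J_def)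
    then obtain \<tau> :: "'n \<Rightarrow> nat" and u where
      \<tau>: "inj_on \<tau> (slots m \<tau>)" "\<tau> ` slots m \<tau> = J'" "v x i = (\<Sum>k\<in>slots m \<tau>. (u $ k) *\<^sub>R v x (\<tau> k))"
      using slots_for_span[OF _ J'(2) B(2)[unfolded J'(3)]] by blast
    then have "in_gradient_span b m c \<tau> x u (v x i)"
      using J'(1) by (auto simp: in_gradient_span_def v_def J_def)
    then show False using good[of i \<tau>] i \<tau> unfolding J_def v_def by blast
  qed
  then show ?thesis using B(2) J' by simp
qed

theorem theorem3p5:
  fixes a :: "'n::finite \<Rightarrow> nat" and b :: "nat \<Rightarrow> nat" and m :: nat and \<E> \<I> :: "nat set"
  assumes "\<And>i. a i > 0"
    and "\<And>j. j \<in> {1..m} \<Longrightarrow> b j > 0"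
    and "\<E> \<inter> \<I> = {}" and "\<E> \<union> \<I> = {1..m}"
  shows "AE c in coeff_measure a b m.
    (let F = poly_map a c; g = poly_constraint b c; X = feasible_set \<E> \<I> g
     in SOL X F \<subseteq> KKT_set \<E> \<I> F g \<and> finite (KKT_set \<E> \<I> F g))"
proof -
  let ?M = "coeff_measure a b m"
  have "AE c in ?M. \<forall>i \<tau>. i \<in> {1..m} \<and> i \<notin> \<tau> ` slots m \<tau> \<and> inj_on \<tau> (slots m \<tau>) \<longrightarrow>
      \<not> (\<exists>x u. in_gradient_span b m c \<tau> x u (gradient (poly_constraint b c i) x) \<and> poly_constraint b c i x = 0)"
    unfolding AE_all_countable
    using AE_not_gradient_span_of_others[of _ m b _ a] assms(2) by (auto intro!: AE_impI)
  moreover have "AE c in ?M. \<forall>\<tau>. inj_on \<tau> (slots m \<tau>) \<longrightarrow>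
      finite {x. \<exists>u. in_gradient_span b m c \<tau> x u (poly_map a c x)}"
    unfolding AE_all_countable
  proof (intro allI AE_impI)
    fix \<tau> :: "'n \<Rightarrow> nat" assume inj: "inj_on \<tau> (slots m \<tau>)"
    show "AE c in ?M. finite {x. \<exists>u. in_gradient_span b m c \<tau> x u (poly_map a c x)}"
      unfolding poly_map_sum[where b = b and m = m]
    proof (rule AE_finite_gradient_span[OF inj, where \<pi> = "\<lambda>l. (Inl l, \<lambda>_. 0)"])
      show "polynomial_function (\<lambda>x. \<chi> i. if fst \<iota> = Inl i then monomial (snd \<iota>) x else 0)"
        for \<iota> :: "('n + nat) \<times> ('n \<Rightarrow> nat)"
      proof (rule polynomial_function_vec_lambda)
        show "real_polynomial_function (\<lambda>x. if fst \<iota> = Inl i then monomial (snd \<iota>) x else 0)" for i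
          using gradient_monomial_poly(1) real_polynomial_function.intros(2)[of 0]
          by (cases "fst \<iota> = Inl i") simp_all
      qed
    qed (auto simp: coeff_index_def exponents_def monomial_0 vec_eq_iff axis_def)
  qed
  ultimately show ?thesis
  proof eventually_elim
    case (elim c)
    define g where "g = poly_constraint b c"
    define v where "v x j = gradient (g j) x" for x j
    define J where "J x = {j \<in> {1..m}. g j x = 0}" for x
    have licq: "inj_on (v x) (J x)" "independent (v x ` J x)" for x
      using active_gradients_independent[of m b c x] elim(1) unfolding v_def J_def g_def by blast+
    have "SOL (feasible_set \<E> \<I> g) (poly_map a c) \<subseteq> KKT_set \<E> \<I> (poly_map a c) g"
    proof
      fix x assume "x \<in> SOL (feasible_set \<E> \<I> g) (poly_map a c)"
      then have x: "x \<in> feasible_set \<E> \<I> g"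
        and min: "\<And>y. y \<in> feasible_set \<E> \<I> g \<Longrightarrow> (y - x) \<bullet> poly_map a c x \<ge> 0"
        by (auto simp: SOL_def)
      have "\<exists>\<mu>. poly_map a c x = (\<Sum>j\<in>\<E> \<union> \<I>. \<mu> j *\<^sub>R v x j) \<and> (\<forall>i\<in>\<I>. \<mu> i \<ge> 0 \<and> \<mu> i * g i x = 0)"
        by (rule KKT_multipliers_exist[OF _ assms(3) _ _ x min _ licq])
          (auto simp: assms(4) J_def v_def g_def continuous_poly_constraint GDERIV_poly_constraint)
      then show "x \<in> KKT_set \<E> \<I> (poly_map a c) g"
        using x unfolding KKT_set_def v_def feasible_set_def by blast
    qed
    moreover have "finite (KKT_set \<E> \<I> (poly_map a c) g)"
    proof (rule finite_subset)
      let ?T = "{\<tau>::'n \<Rightarrow> nat. range \<tau> \<subseteq> {..m} \<and> inj_on \<tau> (slots m \<tau>)}"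
      show "KKT_set \<E> \<I> (poly_map a c) g \<subseteq>
          (\<Union>\<tau>\<in>?T. {x. \<exists>u. in_gradient_span b m c \<tau> x u (poly_map a c x)})"
      proof
        fix x assume "x \<in> KKT_set \<E> \<I> (poly_map a c) g"
        then obtain \<mu> where \<mu>: "poly_map a c x = (\<Sum>j\<in>{1..m}. \<mu> j *\<^sub>R v x j)"
            "\<And>j. j \<in> {1..m} \<Longrightarrow> g j x = 0 \<or> \<mu> j = 0"
          unfolding KKT_set_def assms(4) v_def using assms(4)[symmetric] by fastforce
        note \<mu>(1)
        also have "(\<Sum>j\<in>{1..m}. \<mu> j *\<^sub>R v x j) = (\<Sum>j\<in>J x. \<mu> j *\<^sub>R v x j)"
          using \<mu>(2) by (intro sum.mono_neutral_right) (fastforce simp: J_def)+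
        finally have "poly_map a c x \<in> span (v x ` J x)"
          by (auto intro!: span_sum span_scale intro: span_base)
        moreover have Jm: "J x \<subseteq> {1..m}" by (auto simp: J_def)
        ultimately obtain \<tau> :: "'n \<Rightarrow> nat" and u where \<tau>: "range \<tau> \<subseteq> {..m}" "inj_on \<tau> (slots m \<tau>)"
            "\<tau> ` slots m \<tau> = J x" "poly_map a c x = (\<Sum>k\<in>slots m \<tau>. (u $ k) *\<^sub>R v x (\<tau> k))"
          using slots_for_span[OF Jm licq] by blast
        then have "in_gradient_span b m c \<tau> x u (poly_map a c x)"
          by (auto simp: in_gradient_span_def v_def J_def g_def)
        then show "x \<in> (\<Union>\<tau>\<in>?T. {x. \<exists>u. in_gradient_span b m c \<tau> x u (poly_map a c x)})"
          using \<tau> by blast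
      qed
      have "?T \<subseteq> PiE UNIV (\<lambda>_. {..m})" by auto
      then have "finite ?T" by (rule finite_subset) (auto intro: finite_PiE)
      then show "finite (\<Union>\<tau>\<in>?T. {x. \<exists>u. in_gradient_span b m c \<tau> x u (poly_map a c x)})"
        using elim(2) by auto
    qed
    ultimately show ?case by (simp add: g_def Let_def)
  qed
qed

end
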